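(* Let $V$ be a reflexive Banach space and a vector lattice with $V_+$ closed, let $V\hookrightarrow H\hookrightarrow V^*$ be a Gelfand triple with $V$ compactly embedded in $H$, let $U_{ad}\subset H$ be non-empty, closed and convex, let $\nu>0$, $y_d\in H$, and let $(y^*,u^* )$ be an arbitrary local minimiser of $$\min_{\substack{u\in U_{ad}\\ y\in\mathbf Q(u)}}J(y,u),\qquad J(y,u):=\frac12\|y-y_d\|_H^2+\frac\nu2\|u\|_H^2 .$$ Assume: (1) there exists $v_0\in V$ with $v_0\le\Phi(v)$ for all $v\in V$; $\Phi\colon V\to V$ is completely continuous; there exists $\epsilon>0$ such that $\Phi\colon V\to V$ is continuously Fréchet differentiable on $B_\epsilon(y^* )$; and $\mathbf Q$ is single valued; (2) $(\mathrm I-\Phi'(z))\colon V\to V$ is invertible for $z\in B_\epsilon(y^* )$, and $A(\mathrm I-\Phi'(z))^{-1}\colon V\to V^*$ is uniformly bounded and uniformly coercive in $z\in B_\epsilon(y^* )$; (3) there is a family $\{m_\rho\}_{\rho>0}$ of penalty maps as in the context such that, in addition, each $m_\rho\colon H\to V^*$ is continuous and each $m_\rho\colon V\to V^*$ is continuously Fréchet differentiable. Then there exist multipliers $(p^*,\xi^*,\lambda^* )\in V\times V^*\times V^*$ satisfying $$\begin{aligned} y^*+(\mathrm I-\Phi'(y^* ))^*\lambda^*+A^*p^*&=y_d,\\ Ay^*-u^*+\xi^*&=0,\\ \xi^*\ge0\text{ in }V^*,\quad y^*\le\Phi(y^* ),\quad\langle\xi^*,y^*-\Phi(y^* )\rangle&=0,\\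 u^*\in U_{ad}:\quad(\nu u^*-p^*,u^*-v)_H&\le0\quad\forall v\in U_{ad},\\ \langle\lambda^*,p^*\rangle&\ge0 . \end{aligned}$$
   Context: All spaces are real. $V$ is a vector lattice for a partial order $\le$ ($u\le v$ implies $u+w\le v+w$ and $\lambda u\le\lambda v$ for $w\in V,\lambda\ge0$; $\inf(u,v),\sup(u,v)$ exist in $V$); $V_+:=\{v\in V:v\ge0\}$; $g_1\le g_2$ in $V^*$ means $\langle g_2-g_1,v\rangle\ge0$ for all $v\in V_+$. Gelfand triple: $V$ is continuously and densely embedded in the Hilbert space $H$, which is identified with its dual. With $u^+:=\sup(0,u)$, $u^-:=u^+-u$, $A\colon V\to V^*$ is linear and $C_a,C_b>0$ are constants with $\langle Au,v\rangle\le C_b\|u\|_V\|v\|_V$, $\langle Au,u\rangle\ge C_a\|u\|_V^2$, $\langle Au^+,u^-\rangle\le0$ for all $u,v\in V$; $A^*\colon V\to V^*$ is its adjoint. $\Phi\colon V\to V$ is a given map; completely continuous means $v_n\rightharpoonup v$ in $V$ implies $\Phi(v_n)\to\Phi(v)$ in $V$. $B_\epsilon(y^* )$ is the closed ball in $V$. $\mathbf Q(g)$ ($g\in V^*$) is the set of all $y\in V$ with $y\le\Phi(y)$ and $\langle Ay-g,y-v\rangle\le0$ for all $v\in V$ with $v\le\Phi(y)$; single valued means that $\mathbf Q(g)$ is always a singleton. $(y^*,u^* )$ is a local minimiser if $u^*\in U_{ad}$, $y^*=\mathbf Q(u^* )$, and there is $\gamma>0$ with $J(y^*,u^* )\le J(\mathbf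 Q(u),u)$ for all $u\in U_{ad}$ with $\|u-u^*\|_H\le\gamma$. Uniformly bounded and uniformly coercive: there are constants $C_a',C_b'>0$ independent of $z\in B_\epsilon(y^* )$ with $\|A(\mathrm I-\Phi'(z))^{-1}w\|_{V^*}\le C_b'\|w\|_V$ and $\langle A(\mathrm I-\Phi'(z))^{-1}w,w\rangle\ge C_a'\|w\|_V^2$ for all $w\in V$. Penalty maps: for each $\rho>0$, $m_\rho\colon V\to V^*$ is hemicontinuous ($s\mapsto\langle m_\rho(x+sy),z\rangle$ is continuous for all $x,y,z\in V$) and: (i) $m_\rho(v)=0$ if $v\le0$; (ii) $\langle m_\rho(u)-m_\rho(v),u-v\rangle\ge0$ for all $u,v\in V$; (iii) if $z_\rho\rightharpoonup z$ in $V$ and $m_\rho(z_\rho)\to0$ in $V^*$ as $\rho\to0$, then $z\le0$. "$m_\rho\colon H\to V^*$ continuous" means that $m_\rho$ is defined on $H$ and continuous there. *)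

theory Defs
  imports "HOL-Analysis.Analysis"
begin

text \<open>
  The dual space \<open>V\<^sup>*\<close> of a normed space \<^typ>\<open>'v\<close> is \<^typ>\<open>'v \<Rightarrow>\<^sub>L real\<close>, with the operator norm.
  A vector lattice that is a Banach space is a type of sort
  \<open>{banach, ordered_real_vector, lattice}\<close>; no compatibility between norm and order is built in.
  The inclusion of \<open>V\<close> into the Hilbert space \<open>H\<close> is an explicit operator \<open>\<iota>\<close>.
\<close>

definition reflexive_space :: "'v::real_normed_vector itself \<Rightarrow> bool" where
  "reflexive_space _ \<longleftrightarrow>
     (\<forall>F :: ('v \<Rightarrow>\<^sub>L real) \<Rightarrow>\<^sub>L real. \<exists>v::'v. \<forall>f. blinfun_apply F f = blinfun_apply f v)"

definition weak_tendsto :: "('a \<Rightarrow> 'v::real_normed_vector) \<Rightarrow> 'v \<Rightarrow> 'a filter \<Rightarrow> bool" where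
  "weak_tendsto f x F \<longleftrightarrow>
     (\<forall>g :: 'v \<Rightarrow>\<^sub>L real. ((\<lambda>n. blinfun_apply g (f n)) \<longlongrightarrow> blinfun_apply g x) F)"

definition completely_continuous ::
  "('v::real_normed_vector \<Rightarrow> 'w::real_normed_vector) \<Rightarrow> bool" where
  "completely_continuous f \<longleftrightarrow>
     (\<forall>X x. weak_tendsto X x sequentially \<longrightarrow> (\<lambda>n. f (X n)) \<longlonglongrightarrow> f x)"

definition has_continuous_frechet_derivative_on ::
  "('v::real_normed_vector \<Rightarrow> 'w::real_normed_vector) \<Rightarrow> ('v \<Rightarrow> 'v \<Rightarrow>\<^sub>L 'w) \<Rightarrow> 'v set \<Rightarrow> bool" where
  "has_continuous_frechet_derivative_on f f' S \<longleftrightarrow>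
     (\<forall>x\<in>S. (f has_derivative blinfun_apply (f' x)) (at x)) \<and> continuous_on S f'"

definition dual_le ::
  "('v::{real_normed_vector, ordered_real_vector} \<Rightarrow>\<^sub>L real) \<Rightarrow> ('v \<Rightarrow>\<^sub>L real) \<Rightarrow> bool" where
  "dual_le g1 g2 \<longleftrightarrow> (\<forall>v\<ge>0. blinfun_apply (g2 - g1) v \<ge> 0)"

definition pos_part :: "'v::{ordered_real_vector, lattice} \<Rightarrow> 'v" where
  "pos_part u = sup 0 u"

definition neg_part :: "'v::{ordered_real_vector, lattice} \<Rightarrow> 'v" where
  "neg_part u = pos_part u - u"

definition gelfand_embedding ::
  "('v::banach \<Rightarrow>\<^sub>L 'h::{real_inner, complete_space}) \<Rightarrow> bool" where
  "gelfand_embedding \<iota> \<longleftrightarrow> inj (blinfun_apply \<iota>) \<and> closure (range (blinfun_apply \<iota>)) = UNIV"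

definition compact_embedding ::
  "('v::real_normed_vector \<Rightarrow>\<^sub>L 'h::real_normed_vector) \<Rightarrow> bool" where
  "compact_embedding \<iota> \<longleftrightarrow> (\<forall>S. bounded S \<longrightarrow> compact (closure (blinfun_apply \<iota> ` S)))"

text \<open>\<open>H \<hookrightarrow> V\<^sup>*\<close>, through the Riesz identification of \<open>H\<close> with its dual: \<open>\<langle>h, v\<rangle> = (h, \<iota> v)\<^sub>H\<close>.\<close>

definition into_dual ::
  "('v::real_normed_vector \<Rightarrow>\<^sub>L 'h::real_inner) \<Rightarrow> 'h \<Rightarrow> ('v \<Rightarrow>\<^sub>L real)" where
  "into_dual \<iota> h = blinfun_inner_right h o\<^sub>L \<iota>"

text \<open>
  The adjoint \<open>V \<rightarrow> V\<^sup>*\<close> of an operator \<open>A : V \<rightarrow> V\<^sup>*\<close>, with \<open>V\<^sup>*\<^sup>*\<close> identified with \<open>V\<close>: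
  \<open>\<langle>A\<^sup>* p, v\<rangle> = \<langle>A v, p\<rangle>\<close>.
\<close>

lift_definition form_adjoint ::
  "('v::real_normed_vector \<Rightarrow>\<^sub>L 'v \<Rightarrow>\<^sub>L real) \<Rightarrow> 'v \<Rightarrow> ('v \<Rightarrow>\<^sub>L real)"
  is "\<lambda>A p v. blinfun_apply (blinfun_apply A v) p"
  by (intro bounded_linear_intros)

definition dual_map ::
  "('v::real_normed_vector \<Rightarrow>\<^sub>L 'w::real_normed_vector) \<Rightarrow> ('w \<Rightarrow>\<^sub>L real) \<Rightarrow> ('v \<Rightarrow>\<^sub>L real)" where
  "dual_map T f = f o\<^sub>L T"

definition qvi_solutions ::
  "('v::{real_normed_vector, ordered_real_vector} \<Rightarrow>\<^sub>L 'v \<Rightarrow>\<^sub>L real) \<Rightarrow> ('v \<Rightarrow> 'v) \<Rightarrow>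
   ('v \<Rightarrow>\<^sub>L real) \<Rightarrow> 'v set" where
  "qvi_solutions A \<Phi> g =
     {y. y \<le> \<Phi> y \<and> (\<forall>v. v \<le> \<Phi> y \<longrightarrow> blinfun_apply (blinfun_apply A y - g) (y - v) \<le> 0)}"

definition cost ::
  "('v::real_normed_vector \<Rightarrow>\<^sub>L 'h::real_inner) \<Rightarrow> real \<Rightarrow> 'h \<Rightarrow> 'v \<Rightarrow> 'h \<Rightarrow> real" where
  "cost \<iota> \<nu> y\<^sub>d y u = 1/2 * (norm (blinfun_apply \<iota> y - y\<^sub>d))\<^sup>2 + \<nu>/2 * (norm u)\<^sup>2"

definition local_minimiser ::
  "('v::{real_normed_vector, ordered_real_vector} \<Rightarrow>\<^sub>L 'h::real_inner) \<Rightarrow>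
   ('v \<Rightarrow>\<^sub>L 'v \<Rightarrow>\<^sub>L real) \<Rightarrow> ('v \<Rightarrow> 'v) \<Rightarrow> 'h set \<Rightarrow> real \<Rightarrow> 'h \<Rightarrow> 'v \<Rightarrow> 'h \<Rightarrow> bool" where
  "local_minimiser \<iota> A \<Phi> U \<nu> y\<^sub>d ys us \<longleftrightarrow>
     us \<in> U \<and> qvi_solutions A \<Phi> (into_dual \<iota> us) = {ys} \<and>
     (\<exists>\<gamma>>0. \<forall>u\<in>U. norm (u - us) \<le> \<gamma> \<longrightarrow>
        (\<forall>y\<in>qvi_solutions A \<Phi> (into_dual \<iota> u). cost \<iota> \<nu> y\<^sub>d ys us \<le> cost \<iota> \<nu> y\<^sub>d y u))"

definition hemicontinuous :: "('v::real_normed_vector \<Rightarrow> 'v \<Rightarrow>\<^sub>L real) \<Rightarrow> bool" where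
  "hemicontinuous f \<longleftrightarrow>
     (\<forall>x y z. continuous_on UNIV (\<lambda>s::real. blinfun_apply (f (x + s *\<^sub>R y)) z))"

text \<open>
  Only the members with positive index matter. In the last condition both convergences are along
  the whole family as \<open>\<rho>\<close> tends to \<open>0\<close> from the right.
\<close>

definition penalty_maps ::
  "(real \<Rightarrow> 'v::{real_normed_vector, ordered_real_vector} \<Rightarrow> 'v \<Rightarrow>\<^sub>L real) \<Rightarrow> bool" where
  "penalty_maps m \<longleftrightarrow>
     (\<forall>\<rho>>0. hemicontinuous (m \<rho>)) \<and>
     (\<forall>\<rho>>0. \<forall>v\<le>0. m \<rho> v = 0) \<and>
     (\<forall>\<rho>>0. \<forall>u v. blinfun_apply (m \<rho> u - m \<rho> v) (u - v) \<ge> 0) \<and>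
     (\<forall>z\<^sub>\<rho> z. weak_tendsto z\<^sub>\<rho> z (at_right 0) \<longrightarrow>
        ((\<lambda>\<rho>. m \<rho> (z\<^sub>\<rho> \<rho>)) \<longlongrightarrow> 0) (at_right 0) \<longrightarrow> z \<le> 0)"

end

theory Submission
  imports Defs
begin

text \<open>
  Near \<open>y\<^sup>*\<close> the coercivity of \<open>A (I - \<Phi>')\<^sup>-\<^sup>1\<close> gives
  \<open>\<langle>A (y - z), (I - \<Phi>) y - (I - \<Phi>) z\<rangle> \<ge> c \<parallel>y - z\<parallel>\<^sup>2\<close>. The inequality \<open>y \<le> \<Phi> y\<close> is replaced by a
  monotone penalty term \<open>P\<^sub>n (y - \<Phi> y)\<close>, and the penalised state equation is in turn only penalised:
  the quadratic penalty \<open>N(r) / (2 \<tau>)\<close> is put on its residual \<open>r\<close>, where \<open>N(r) = \<langle>r, J r\<rangle>\<close> and \<open>J\<close> is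
  the Riesz operator of the symmetrised form of \<open>A\<close>. Then \<open>p = J r / \<tau>\<close> is automatically a multiplier,
  so that no differentiability of the control-to-state map is needed, and Ekeland's principle
  supplies almost stationary points without weak lower semicontinuity. Testing the adjoint equation
  with \<open>(I - \<Phi>')\<^sup>-\<^sup>1 p\<close> bounds \<open>p\<close> in \<open>V\<close>. Hence \<open>p\<close> converges in \<open>H\<close> along a subsequence, and
  the variational inequality for the controls makes them converge strongly, to \<open>u\<^sup>*\<close> because of the
  additional cost \<open>\<parallel>u - u\<^sup>*\<parallel>\<^sup>2 / 2\<close>. Since \<open>\<lambda>\<^sup>*\<close> is determined by \<open>p\<^sup>*\<close> through the adjoint
  equation, only the weak limit of \<open>p\<close> is needed, and the sign of \<open>\<langle>\<lambda>\<^sup>*, p\<^sup>*\<rangle>\<close> follows from the weak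
  lower semicontinuity of a coercive quadratic form.

  Along a single sequence \<open>\<rho> \<rightarrow> 0\<close> the given maps \<open>m\<^sub>\<rho>\<close> need not detect \<open>v \<le> 0\<close>, because the
  hypothesis on them concerns the whole family. On constant families it says that \<open>v \<le> 0\<close> as soon as
  \<open>m\<^sub>\<rho> v = 0\<close> for all \<open>\<rho>\<close>; by compactness in \<open>H\<close>, finite sums of them serve as penalties.
\<close>

section \<open>Minimisation and weak compactness\<close>

lemma Cauchy_of_square_bound:
  fixes X :: "nat \<Rightarrow> 'a::real_normed_vector"
  assumes "e \<longlonglongrightarrow> 0" "\<And>n m. n \<le> m \<Longrightarrow> (norm (X n - X m))\<^sup>2 \<le> e n"
  shows "Cauchy X"
  unfolding Cauchy_altdef
proof (intro allI impI)
  fix r :: real assume r: "r > 0"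
  have "eventually (\<lambda>n. e n < r\<^sup>2) sequentially"
    using assms(1) r by (intro order_tendstoD) auto
  then obtain N where N: "\<And>n. n \<ge> N \<Longrightarrow> e n < r\<^sup>2"
    by (auto simp: eventually_sequentially)
  show "\<exists>M. \<forall>m\<ge>M. \<forall>n>m. dist (X m) (X n) < r"
  proof (intro exI allI impI)
    fix m n assume "N \<le> m" "m < n"
    then have "(norm (X m - X n))\<^sup>2 < r\<^sup>2"
      using assms(2)[of m n] N[of m] by simp
    then show "dist (X m) (X n) < r"
      unfolding dist_norm using r by (simp add: power2_less_imp_less)
  qed
qed

text \<open>By the parallelogram identity, almost minimisers of \<open>A x x - g x\<close> over a
  decreasing sequence of convex sets form a Cauchy sequence. A constant sequence of sets gives the
  Riesz operator, convex hulls of tails give weak limits. Such hulls are not closed in general, so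
  \<open>v\<close> is only described as a limit of points \<open>X n\<close>.\<close>

lemma nested_convex_minimiser:
  fixes A :: "'v::banach \<Rightarrow>\<^sub>L 'v \<Rightarrow>\<^sub>L real" and g :: "'v \<Rightarrow>\<^sub>L real" and K :: "nat \<Rightarrow> 'v set"
  assumes C: "C > 0" "\<And>u. C * (norm u)\<^sup>2 \<le> A u u"
    and K: "\<And>n. convex (K n)" "decseq K" "\<And>n. \<exists>x\<in>K n. A x x - g x \<le> B"
  shows "\<exists>X v. (\<forall>n. X n \<in> K n) \<and> X \<longlonglongrightarrow> v \<and>
    (\<forall>x. (\<forall>n. x \<in> K n) \<longrightarrow> A v v - g v \<le> A x x - g x)"
proof -
  define f where "f = (\<lambda>x. A x x - g x)"
  define d where "d = (\<lambda>n. Inf (f ` K n))"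
  \<comment> \<open>Completing the square in \<open>norm x\<close> bounds \<open>f\<close> from
    below, so the infima \<open>d n\<close> are meaningful; they increase and stay below
    \<open>B\<close>.\<close>
  have low: "- (norm g)\<^sup>2 / (4 * C) \<le> f x" for x
  proof -
    have "g x \<le> norm g * norm x" using norm_blinfun[of g x] by simp
    then have "f x \<ge> C * (norm x)\<^sup>2 - norm g * norm x"
      unfolding f_def using C(2)[of x] by linarith
    moreover have "C * (norm x)\<^sup>2 - norm g * norm x + (norm g)\<^sup>2 / (4 * C)
        = C * (norm x - norm g / (2 * C))\<^sup>2"
      using C(1) by (simp add: field_simps power2_eq_square)
    moreover have "\<dots> \<ge> 0" using C(1) by simp
    ultimately show ?thesis by simp
  qed
  then have bdd: "bdd_below (f ` S)" for S by (auto intro!: bdd_belowI2)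
  have ne: "K n \<noteq> {}" for n using K(3)[of n] by auto
  have dle: "d n \<le> f x" if "x \<in> K n" for n x
    unfolding d_def using that bdd by (simp add: cINF_lower)
  have dB: "d n \<le> B" for n
    using K(3)[of n] dle unfolding f_def by force
  have dmono: "incseq d"
    unfolding incseq_def d_def
    by (intro allI impI cINF_superset_mono ne bdd decseqD[OF K(2)]) auto
  obtain D where D: "d \<longlonglongrightarrow> D" "\<And>n. d n \<le> D"
    using incseq_convergent[OF dmono, of B] dB by auto
  have "\<exists>x\<in>K n. f x < d n + 1 / real (Suc n)" for n
    using cINF_less_iff[OF ne bdd, of n "d n + 1 / real (Suc n)"] unfolding d_def by auto
  then obtain X where X: "\<And>n. X n \<in> K n" "\<And>n. f (X n) < d n + 1 / real (Suc n)"
    by metis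
  \<comment> \<open>The linear part cancels and the mixed terms combine to
    \<open>A (a - b) (a - b)\<close>, also for a form that is not symmetric.\<close>
  have par: "C * (norm (a - b))\<^sup>2 \<le> 2 * (f a + f b) - 4 * f ((1/2) *\<^sub>R a + (1/2) *\<^sub>R b)" for a b
  proof -
    have "2 * (f a + f b) - 4 * f ((1/2) *\<^sub>R a + (1/2) *\<^sub>R b) = A (a - b) (a - b)"
      unfolding f_def by (simp add: blinfun.bilinear_simps algebra_simps)
    then show ?thesis using C(2)[of "a - b"] by simp
  qed
  have "Cauchy X"
  proof (rule Cauchy_of_square_bound)
    have "(\<lambda>n. (2 * (D - d n) + 4 / real (Suc n)) / C) \<longlonglongrightarrow> (2 * (D - D) + 0) / C"
      using C(1) by (intro tendsto_intros D LIMSEQ_Suc[OF lim_const_over_n]) auto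
    then show "(\<lambda>n. (2 * (D - d n) + 4 / real (Suc n)) / C) \<longlonglongrightarrow> 0" by simp
  next
    fix n m :: nat assume nm: "n \<le> m"
    have "X m \<in> K n" using X(1)[of m] K(2) nm by (auto simp: decseq_def)
    then have "(1/2) *\<^sub>R X n + (1/2) *\<^sub>R X m \<in> K n"
      using K(1)[of n] X(1)[of n] by (auto simp: convex_def)
    then have "C * (norm (X n - X m))\<^sup>2 \<le> 2 * (f (X n) + f (X m)) - 4 * d n"
      using par[of "X n" "X m"] dle by force
    also have "\<dots> \<le> 2 * (d n + 1 / real (Suc n) + (D + 1 / real (Suc n))) - 4 * d n"
    proof -
      have "1 / real (Suc m) \<le> 1 / real (Suc n)" using nm by (simp add: frac_le)
      then show ?thesis using X(2)[of n] X(2)[of m] D(2)[of m] by argo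
    qed
    finally have "C * (norm (X n - X m))\<^sup>2 \<le> 2 * (D - d n) + 4 / real (Suc n)"
      by (simp add: algebra_simps)
    then show "(norm (X n - X m))\<^sup>2 \<le> (2 * (D - d n) + 4 / real (Suc n)) / C"
      using C(1) by (simp add: pos_le_divide_eq mult.commute)
  qed
  then obtain v where v: "X \<longlonglongrightarrow> v" using Cauchy_convergent convergent_def by blast
  have "f v \<le> f x" if x: "\<And>n. x \<in> K n" for x
  proof (rule LIMSEQ_le)
    show "(\<lambda>n. f (X n)) \<longlonglongrightarrow> f v" unfolding f_def by (intro tendsto_intros v)
    show "(\<lambda>n. f x + 1 / real (Suc n)) \<longlonglongrightarrow> f x"
      using tendsto_add[OF tendsto_const LIMSEQ_Suc[OF lim_const_over_n], of "f x" 1] by simp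
    show "\<exists>N. \<forall>n\<ge>N. f (X n) \<le> f x + 1 / real (Suc n)"
    proof (intro exI allI impI)
      fix n show "f (X n) \<le> f x + 1 / real (Suc n)" using X(2)[of n] dle[OF x, of n] by linarith
    qed
  qed
  then show ?thesis using X(1) v unfolding f_def by blast
qed

text \<open>\<open>J\<close> inverts the symmetrised form \<open>A v x + A x v\<close>: its equation
  is the Euler equation for minimising \<open>A x x - g x\<close>. Both \<open>g (J h)\<close> and
  \<open>h (J g)\<close> equal this form at \<open>J g\<close> and \<open>J h\<close>, whence the
  symmetry. Thus \<open>g (J g)\<close> is a differentiable substitute for the squared dual
  norm.\<close>

lemma riesz_operator:
  fixes A :: "'v::banach \<Rightarrow>\<^sub>L 'v \<Rightarrow>\<^sub>L real"
  assumes C: "C > 0" "\<And>u. C * (norm u)\<^sup>2 \<le> A u u"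
  shows "\<exists>J :: ('v \<Rightarrow>\<^sub>L real) \<Rightarrow>\<^sub>L 'v. (\<forall>g h. blinfun_apply g (J h) = blinfun_apply h (J g)) \<and>
    (\<exists>k>0. \<forall>g. k * (norm g)\<^sup>2 \<le> blinfun_apply g (J g))"
proof -
  have "\<exists>v. \<forall>x. A v x + A x v = g x" for g :: "'v \<Rightarrow>\<^sub>L real"
  proof -
    have "\<exists>x\<in>UNIV. A x x - g x \<le> 0" by (rule bexI[of _ 0]) auto
    from nested_convex_minimiser[where A = A and g = g, OF C, of "\<lambda>_. UNIV" 0]
    obtain v where v: "\<And>x. A v v - g v \<le> A x x - g x" 
      using \<open>\<exists>x\<in>UNIV. A x x - g x \<le> 0\<close> by (auto simp: decseq_def)
    have "A v x + A x v = g x" for x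
    proof -
      define b where "b = A v x + A x v - g x"
      \<comment> \<open>At \<open>t = - b * s\<close> the variation equals
        \<open>b^2 * s * (s * A x x - 1)\<close>. The \<open>+ 1\<close> in the denominator makes
        the last factor negative, so \<open>b\<close> must vanish.\<close>
      define s where "s = 1 / (A x x + 1)"
      have pos: "A x x \<ge> 0" using C(2)[of x] C(1) by (smt (verit) mult_nonneg_nonneg zero_le_power2)
      have "0 \<le> t * b + t\<^sup>2 * A x x" for t
        using v[of "v + t *\<^sub>R x"] unfolding b_def
        by (simp add: blinfun.bilinear_simps algebra_simps power2_eq_square)
      from this[of "- b * s"] have "0 \<le> b\<^sup>2 * s * (s * A x x - 1)"
        by (simp add: algebra_simps power2_eq_square)
      moreover have "s * A x x - 1 < 0" "s > 0" using pos by (auto simp: s_def field_simps)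
      ultimately have "b\<^sup>2 * s \<le> 0" by (simp add: zero_le_mult_iff)
      then have "b = 0" using \<open>s > 0\<close> by (simp add: mult_le_0_iff) 
      then show ?thesis by (simp add: b_def)
    qed
    then show ?thesis by blast
  qed
  then obtain J :: "('v \<Rightarrow>\<^sub>L real) \<Rightarrow> 'v" where J: "\<And>g :: 'v \<Rightarrow>\<^sub>L real. \<And>x. A (J g) x + A x (J g) = g x" by metis
  have norm_le: "2 * C * norm u \<le> norm g" if "\<And>x. A u x + A x u = g x" for u and g :: "'v \<Rightarrow>\<^sub>L real"
  proof -
    have "2 * C * (norm u)\<^sup>2 \<le> norm g * norm u"
      using that[of u] C(2)[of u] norm_blinfun[of g u] by auto
    then show ?thesis by (cases "u = 0") (auto simp: power2_eq_square)
  qed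
  have uniq: "u = v" if "\<And>x. A u x + A x u = A v x + A x v" for u v
  proof -
    have "2 * C * norm (u - v) \<le> norm (0 :: 'v \<Rightarrow>\<^sub>L real)"
    proof (rule norm_le)
      fix x show "A (u - v) x + A x (u - v) = (0 :: 'v \<Rightarrow>\<^sub>L real) x"
        using that[of x] by (simp add: blinfun.bilinear_simps)
    qed
    then show ?thesis using C(1) by (simp add: mult_le_0_iff)
  qed
  have "bounded_linear J"
  proof (rule bounded_linear_intro)
    fix g h :: "'v \<Rightarrow>\<^sub>L real" and r :: real
    have "\<And>x. A (J g + J h) x + A x (J g + J h) = (g + h) x"
    proof -
      fix x show "A (J g + J h) x + A x (J g + J h) = (g + h) x"
        using J[of g x] J[of h x] by (simp add: blinfun.bilinear_simps)
    qed
    then show "J (g + h) = J g + J h" using J by (intro uniq) auto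
    have "\<And>x. A (r *\<^sub>R J g) x + A x (r *\<^sub>R J g) = (r *\<^sub>R g) x"
    proof -
      fix x show "A (r *\<^sub>R J g) x + A x (r *\<^sub>R J g) = (r *\<^sub>R g) x"
        using J[of g x] by (simp add: blinfun.bilinear_simps flip: distrib_left)
    qed
    then show "J (r *\<^sub>R g) = r *\<^sub>R J g" using J by (intro uniq) auto
    show "norm (J g) \<le> norm g * (1 / (2 * C))"
      using norm_le[OF J] C(1) by (simp add: field_simps)
  qed
  then have BJ: "blinfun_apply (Blinfun J) = J" by (rule bounded_linear_Blinfun_apply)
  have sym: "g (J h) = h (J g)" for g h :: "'v \<Rightarrow>\<^sub>L real"
    using J[of g "J h"] J[of h "J g"] by simp
  \<comment> \<open>Combines \<open>norm g \<le> (2 * norm A + 1) * norm (J g)\<close> with the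
    coercivity at \<open>J g\<close>; the \<open>+ 1\<close> keeps the denominator positive when
    \<open>A = 0\<close>.\<close>
  define k where "k = 2 * C / (2 * norm A + 1)\<^sup>2"
  have "2 * norm A + 1 > 0" by (simp add: add_nonneg_pos)
  have "k * (norm g)\<^sup>2 \<le> g (J g)" for g :: "'v \<Rightarrow>\<^sub>L real"
  proof -
    have "norm g \<le> (2 * norm A + 1) * norm (J g)"
    proof (rule norm_blinfun_bound)
      fix x
      have *: "\<bar>A a b\<bar> \<le> norm A * norm a * norm b" for a b
        using norm_blinfun[of "A a" b] norm_blinfun[of A a]
        by (smt (verit) mult_right_mono norm_ge_zero real_norm_def)
      have "\<bar>g x\<bar> \<le> 2 * norm A * norm (J g) * norm x"
        using *[of "J g" x] *[of x "J g"] J[of g x] by (simp add: algebra_simps)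
      also have "\<dots> \<le> (2 * norm A + 1) * norm (J g) * norm x"
        by (intro mult_right_mono) auto
      finally show "norm (g x) \<le> (2 * norm A + 1) * norm (J g) * norm x" by simp
    qed (use norm_ge_zero in \<open>auto intro!: mult_nonneg_nonneg add_nonneg_nonneg\<close>)
    then have "(norm g)\<^sup>2 \<le> ((2 * norm A + 1) * norm (J g))\<^sup>2" by (intro power_mono) auto
    then have "k * (norm g)\<^sup>2 \<le> k * ((2 * norm A + 1) * norm (J g))\<^sup>2"
      using C(1) by (intro mult_left_mono) (auto simp: k_def)
    also have "\<dots> = 2 * (C * (norm (J g))\<^sup>2)"
      using \<open>2 * norm A + 1 > 0\<close> by (simp add: k_def power_mult_distrib)
    also have "\<dots> \<le> g (J g)" using C(2)[of "J g"] J[of g "J g"] by simp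
    finally show ?thesis .
  qed
  moreover have "k > 0" using C(1) \<open>2 * norm A + 1 > 0\<close> by (simp add: k_def)
  ultimately show ?thesis using sym BJ by (intro exI[of _ "Blinfun J"]) auto
qed

text \<open>\<open>T x\<close> collects the points that improve on \<open>x\<close> by at least
  \<open>e\<close> times their distance; this relation is transitive. A sequence that nearly
  minimises \<open>f\<close> over \<open>T\<close> of its last member has decreasing values bounded
  below, hence is Cauchy, and its limit lies in every \<open>T (X n)\<close>.\<close>

lemma ekeland:
  fixes f :: "'a::complete_space \<Rightarrow> real"
  assumes S: "closed S" "continuous_on S f" "\<And>x. x \<in> S \<Longrightarrow> 0 \<le> f x"
    and "x0 \<in> S" "e > 0"
  shows "\<exists>x\<in>S. f x \<le> f x0 \<and> (\<forall>z\<in>S. f x \<le> f z + e * dist x z)"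
proof -
  define T where "T = (\<lambda>x. {z \<in> S. f z + e * dist x z \<le> f x})"
  have self: "x \<in> T x" if "x \<in> S" for x using that by (simp add: T_def)
  have TS: "T x \<subseteq> S" for x by (auto simp: T_def)
  have trans: "T z \<subseteq> T x" if "z \<in> T x" for x z
  proof
    fix y assume "y \<in> T z"
    moreover have "e * dist x y \<le> e * dist x z + e * dist z y"
      using dist_triangle[of x y z] \<open>e > 0\<close> by (simp flip: distrib_left)
    ultimately show "y \<in> T x" using that by (auto simp: T_def)
  qed
  have bdd: "bdd_below (f ` T x)" for x using S(3) TS by (intro bdd_belowI2[of _ 0]) auto
  have ex: "\<exists>z\<in>T x. f z < Inf (f ` T x) + 1 / real (Suc n)" if "x \<in> S" for x n
    using cINF_less_iff[OF _ bdd, of x "Inf (f ` T x) + 1 / real (Suc n)"] self[OF that] by auto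
  define s where "s = (\<lambda>n x. SOME z. z \<in> T x \<and> f z < Inf (f ` T x) + 1 / real (Suc n))"
  have s: "s n x \<in> T x" "f (s n x) < Inf (f ` T x) + 1 / real (Suc n)" if "x \<in> S" for n x
    using someI_ex[of "\<lambda>z. z \<in> T x \<and> f z < Inf (f ` T x) + 1 / real (Suc n)"] ex[OF that, of n]
    unfolding s_def by blast+
  define X where "X = rec_nat x0 s"
  have X0: "X 0 = x0" and XS: "X (Suc n) = s n (X n)" for n by (simp_all add: X_def)
  have XinS: "X n \<in> S" for n
  proof (induction n)
    case (Suc n)
    then show ?case using s(1)[of "X n" n] TS[of "X n"] XS by auto
  qed (use X0 \<open>x0 \<in> S\<close> in simp)
  have step: "X (Suc n) \<in> T (X n)" for n using XS s(1)[OF XinS] by simp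
  have mem: "X m \<in> T (X n)" if "n \<le> m" for n m
    using that
  proof (induction m rule: dec_induct)
    case (step m)
    then show ?case using trans \<open>\<And>n. X (Suc n) \<in> T (X n)\<close> by blast
  qed (simp add: self XinS)
  have dec: "decseq (\<lambda>n. f (X n))"
    unfolding decseq_def
  proof (intro allI impI)
    fix n m :: nat assume "n \<le> m"
    then have "f (X m) + e * dist (X n) (X m) \<le> f (X n)" using mem by (auto simp: T_def)
    moreover have "0 \<le> e * dist (X n) (X m)" using \<open>e > 0\<close> by simp
    ultimately show "f (X m) \<le> f (X n)" by linarith
  qed
  obtain L where L: "(\<lambda>n. f (X n)) \<longlonglongrightarrow> L" "\<And>n. L \<le> f (X n)"
    using decseq_convergent[OF dec, of 0] S(3) XinS by auto
  have "Cauchy X"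
    unfolding Cauchy_altdef
  proof (intro allI impI)
    fix r :: real assume "r > 0"
    then have "eventually (\<lambda>n. f (X n) < L + e * r) sequentially"
      using L(1) \<open>e > 0\<close> by (intro order_tendstoD) auto
    then obtain N where N: "\<And>n. n \<ge> N \<Longrightarrow> f (X n) < L + e * r" by (auto simp: eventually_sequentially)
    show "\<exists>M. \<forall>m\<ge>M. \<forall>n>m. dist (X m) (X n) < r"
    proof (intro exI allI impI)
      fix m n assume "N \<le> m" "m < n"
      then have "f (X n) + e * dist (X m) (X n) \<le> f (X m)" using mem[of m n] by (auto simp: T_def)
      then have "e * dist (X m) (X n) < e * r" using N[of m] L(2)[of n] \<open>N \<le> m\<close> by linarith
      then show "dist (X m) (X n) < r" using \<open>e > 0\<close> by simp
    qed
  qed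
  then obtain x where x: "X \<longlonglongrightarrow> x" using Cauchy_convergent convergent_def by blast
  have xS: "x \<in> S" using closed_sequentially[OF S(1) XinS x] .
  have fX: "(\<lambda>n. f (X n)) \<longlonglongrightarrow> f x"
    using continuous_on_tendsto_compose[OF S(2) x xS] XinS by simp
  have xT: "x \<in> T (X n)" for n
  proof -
    have "f x + e * dist (X n) x \<le> f (X n)"
    proof (rule LIMSEQ_le_const2)
      show "(\<lambda>m. f (X m) + e * dist (X n) (X m)) \<longlonglongrightarrow> f x + e * dist (X n) x"
        by (intro tendsto_intros fX x)
      show "\<exists>N. \<forall>m\<ge>N. f (X m) + e * dist (X n) (X m) \<le> f (X n)"
        using mem by (auto simp: T_def)
    qed
    then show ?thesis using xS by (simp add: T_def)
  qed
  \<comment> \<open>A violating \<open>z\<close> lies in every \<open>T (X n)\<close>, where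
    \<open>X (Suc n)\<close> is within \<open>1 / (n + 1)\<close> of the infimum. Hence
    \<open>f x \<le> f z\<close>, against the strict improvement.\<close>
  have "f x \<le> f z + e * dist x z" if "z \<in> S" for z
  proof (rule ccontr)
    assume less: "\<not> ?thesis"
    then have "z \<in> T x" using that by (simp add: T_def)
    then have zT: "z \<in> T (X n)" for n using trans xT by blast
    have "f x \<le> f z"
    proof (rule LIMSEQ_le)
      show "(\<lambda>n. f (X (Suc n))) \<longlonglongrightarrow> f x" using fX by (rule LIMSEQ_Suc)
      show "(\<lambda>n. f z + 1 / real (Suc n)) \<longlonglongrightarrow> f z"
        using tendsto_add[OF tendsto_const LIMSEQ_Suc[OF lim_const_over_n], of "f z" 1] by simp
      have "f (X (Suc n)) \<le> f z + 1 / real (Suc n)" for n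
        using s(2)[OF XinS, of n n] XS[of n] cINF_lower[OF bdd zT, of n] by simp
      then show "\<exists>N. \<forall>n\<ge>N. f (X (Suc n)) \<le> f z + 1 / real (Suc n)" by blast
    qed
    moreover have "0 \<le> e * dist x z" using \<open>e > 0\<close> by simp
    ultimately show False using less by linarith
  qed
  moreover have "f x \<le> f x0"
  proof -
    have "f x + e * dist x0 x \<le> f x0" using xT[of 0] X0 by (simp add: T_def)
    moreover have "0 \<le> e * dist x0 x" using \<open>e > 0\<close> by simp
    ultimately show ?thesis by linarith
  qed
  ultimately show ?thesis using xS by blast
qed

section \<open>Weak limits in \<open>V\<close> through the compact embedding into
  \<open>H\<close>\<close>

locale coercive_embedding =
  fixes \<iota> :: "'v::banach \<Rightarrow>\<^sub>L 'h::{real_inner, complete_space}"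
    and A :: "'v \<Rightarrow>\<^sub>L 'v \<Rightarrow>\<^sub>L real" and C :: real
  assumes C_pos: "C > 0" and coercive: "\<And>u. C * (norm u)\<^sup>2 \<le> A u u"
    and inj_\<iota>: "inj (blinfun_apply \<iota>)" and compact_\<iota>: "compact_embedding \<iota>"
begin

text \<open>Weak limits are obtained without reflexivity, as strong limits of almost minimal convex combinations.\<close>

lemma embedded_limit:
  fixes y :: "nat \<Rightarrow> 'v"
  assumes "bounded (range y)" "(\<lambda>n. \<iota> (y n)) \<longlonglongrightarrow> h"
  shows "\<exists>v. \<iota> v = h \<and> (\<forall>K. closed K \<longrightarrow> convex K \<longrightarrow> (\<forall>n. y n \<in> K) \<longrightarrow> v \<in> K)"
proof -
  obtain R where R: "\<And>n. norm (y n) \<le> R" using assms(1) by (auto simp: bounded_iff)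
  \<comment> \<open>Hulls of tails decrease. With linear term 0 the minimised functional is the form
    itself, which is bounded along \<open>y\<close>.\<close>
  define K where "K = (\<lambda>n. convex hull (y ` {n..}))"
  have "A (y n) (y n) - (0 :: 'v \<Rightarrow>\<^sub>L real) (y n) \<le> norm A * R\<^sup>2" for n
  proof -
    have "\<bar>A (y n) (y n)\<bar> \<le> norm (A (y n)) * norm (y n)" using norm_blinfun[of "A (y n)" "y n"] by simp
    also have "\<dots> \<le> norm A * norm (y n) * norm (y n)"
      using norm_blinfun[of A "y n"] by (intro mult_right_mono) auto
    also have "\<dots> = norm A * (norm (y n))\<^sup>2" by (simp add: power2_eq_square)
    also have "\<dots> \<le> norm A * R\<^sup>2" using R[of n] by (intro mult_left_mono power_mono) auto
    finally show ?thesis by simp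
  qed
  moreover have "y n \<in> K n" for n by (auto simp: K_def intro: hull_inc)
  moreover have "decseq K" unfolding K_def decseq_def by (auto intro!: hull_mono)
  moreover have "convex (K n)" for n by (simp add: K_def convex_convex_hull)
  ultimately obtain X v where X: "\<And>n. X n \<in> K n" "X \<longlonglongrightarrow> v"
    using nested_convex_minimiser[OF C_pos coercive, of K 0 "norm A * R\<^sup>2"] by metis
  \<comment> \<open>A closed convex set that contains a tail contains its hull and hence
    \<open>v\<close>. Preimages of small balls around \<open>h\<close> then give
    \<open>\<iota> v = h\<close>.\<close>
  have "v \<in> S" if S: "closed S" "convex S" and N: "\<And>n. n \<ge> N \<Longrightarrow> y n \<in> S" for S N
  proof (rule Lim_in_closed_set[OF S(1) _ _ X(2)])
    have "X n \<in> S" if "n \<ge> N" for n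
    proof -
      have "K n \<subseteq> S" unfolding K_def by (rule hull_minimal) (use S N that in auto)
      then show ?thesis using X(1) by blast
    qed
    then show "\<forall>\<^sub>F n in sequentially. X n \<in> S" by (auto simp: eventually_sequentially)
  qed simp
  note mem = this
  have "dist h (\<iota> v) \<le> e" if e: "e > 0" for e
  proof -
    obtain N where "\<And>n. n \<ge> N \<Longrightarrow> \<iota> (y n) \<in> cball h e"
      using tendstoD[OF assms(2) e] by (force simp: eventually_sequentially dist_commute)
    moreover have "closed (blinfun_apply \<iota> -` cball h e)"
      by (intro closed_vimage continuous_intros) auto
    moreover have "convex (blinfun_apply \<iota> -` cball h e)"
      by (intro convex_linear_vimage bounded_linear.linear[OF blinfun.bounded_linear_right]) auto
    ultimately have "v \<in> blinfun_apply \<iota> -` cball h e" by (intro mem) auto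
    then show ?thesis by simp
  qed
  then have "\<iota> v = h" by (metis dense_ge dist_le_zero_iff)
  then show ?thesis using mem[of _ 0] by blast
qed

text \<open>As \<open>\<iota>\<close> is injective, all subsequences lead to the same
  \<open>v\<close>, so \<open>v\<close> lies in every closed convex set that contains a subsequence.
  If weak convergence failed, some closed half-space would contain a subsequence but not
  \<open>v\<close>.\<close>

lemma embedded_weak_limit:
  fixes y :: "nat \<Rightarrow> 'v"
  assumes "bounded (range y)" "(\<lambda>n. \<iota> (y n)) \<longlonglongrightarrow> h"
  shows "\<exists>v. \<iota> v = h \<and> weak_tendsto y v sequentially \<and>
    (\<forall>K. closed K \<longrightarrow> convex K \<longrightarrow> (\<forall>n. y n \<in> K) \<longrightarrow> v \<in> K)"
proof -
  obtain v where v: "\<iota> v = h" "\<And>K. closed K \<Longrightarrow> convex K \<Longrightarrow> (\<And>n. y n \<in> K) \<Longrightarrow> v \<in> K"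
    using embedded_limit[OF assms] by blast
  have sub: "v \<in> K" if r: "strict_mono r" and K: "closed K" "convex K" "\<And>n. y (r n) \<in> K"
    for r :: "nat \<Rightarrow> nat" and K
  proof -
    have "bounded (range (y \<circ> r))" by (rule bounded_subset[OF assms(1)]) auto
    moreover have "(\<lambda>n. \<iota> ((y \<circ> r) n)) \<longlonglongrightarrow> h"
      using LIMSEQ_subseq_LIMSEQ[OF assms(2) r] by (simp add: o_def)
    ultimately obtain w where w: "\<iota> w = h"
        "\<And>K. closed K \<Longrightarrow> convex K \<Longrightarrow> (\<And>n. (y \<circ> r) n \<in> K) \<Longrightarrow> w \<in> K"
      using embedded_limit[of "y \<circ> r" h] by blast
    have "w = v" by (rule injD[OF inj_\<iota>]) (simp add: w(1) v(1))
    then show ?thesis using w(2)[OF K(1,2)] K(3) by simp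
  qed
  have "weak_tendsto y v sequentially"
    unfolding weak_tendsto_def
  proof (intro allI order_tendstoI)
    fix g :: "'v \<Rightarrow>\<^sub>L real" and a assume a: "a < g v"
    show "\<forall>\<^sub>F n in sequentially. a < g (y n)"
    proof (rule ccontr)
      assume "\<not> ?thesis"
      then obtain r :: "nat \<Rightarrow> nat" where "strict_mono r" "\<And>n. \<not> a < g (y (r n))"
        using not_eventually_sequentiallyD[of "\<lambda>n. a < g (y n)"] by auto
      then have "v \<in> blinfun_apply g -` {..a}"
        by (intro sub[of r] closed_vimage continuous_intros convex_linear_vimage bounded_linear.linear[OF blinfun.bounded_linear_right])
          (auto simp: not_less)
      then show False using a by simp
    qed
  next
    fix g :: "'v \<Rightarrow>\<^sub>L real" and a assume a: "g v < a"
    show "\<forall>\<^sub>F n in sequentially. g (y n) < a"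
    proof (rule ccontr)
      assume "\<not> ?thesis"
      then obtain r :: "nat \<Rightarrow> nat" where "strict_mono r" "\<And>n. \<not> g (y (r n)) < a"
        using not_eventually_sequentiallyD[of "\<lambda>n. g (y n) < a"] by auto
      then have "v \<in> blinfun_apply g -` {a..}"
        by (intro sub[of r] closed_vimage continuous_intros convex_linear_vimage bounded_linear.linear[OF blinfun.bounded_linear_right])
          (auto simp: not_less)
      then show False using a by simp
    qed
  qed
  then show ?thesis using v by blast
qed

text \<open>Stands in for weak sequential compactness of bounded sets: compactness in
  \<open>H\<close> selects the subsequence, and the previous lemma lifts its limit to
  \<open>V\<close>.\<close>

lemma weakly_convergent_subsequence:
  fixes y :: "nat \<Rightarrow> 'v"
  assumes "bounded (range y)"
  obtains r :: "nat \<Rightarrow> nat" and v where "strict_mono r" "weak_tendsto (\<lambda>n. y (r n)) v sequentially"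
    "(\<lambda>n. \<iota> (y (r n))) \<longlonglongrightarrow> \<iota> v"
    "\<And>K. closed K \<Longrightarrow> convex K \<Longrightarrow> (\<And>n. y n \<in> K) \<Longrightarrow> v \<in> K"
proof -
  have "compact (closure (blinfun_apply \<iota> ` range y))"
    using compact_\<iota> assms by (auto simp: compact_embedding_def)
  moreover have "\<And>n. \<iota> (y n) \<in> closure (blinfun_apply \<iota> ` range y)"
    by (rule subsetD[OF closure_subset]) auto
  ultimately obtain h r where r: "strict_mono r" "((\<lambda>n. \<iota> (y n)) \<circ> r) \<longlonglongrightarrow> h"
    unfolding compact_eq_seq_compact_metric
    using seq_compactE[of "closure (blinfun_apply \<iota> ` range y)" "\<lambda>n. \<iota> (y n)"] by metis
  have "bounded (range (\<lambda>n. y (r n)))" by (rule bounded_subset[OF assms]) auto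
  then obtain v where "\<iota> v = h" "weak_tendsto (\<lambda>n. y (r n)) v sequentially"
      "\<forall>K. closed K \<longrightarrow> convex K \<longrightarrow> (\<forall>n. y (r n) \<in> K) \<longrightarrow> v \<in> K"
    using embedded_weak_limit[of "\<lambda>n. y (r n)" h] r(2) by (auto simp: o_def)
  then show ?thesis using that[OF r(1), of v] r(2) by (auto simp: o_def)
qed

text \<open>The image itself is compact, and not merely its closure, because weak limits of
  sequences in a closed convex set stay in the set.\<close>

lemma compact_embedding_image:
  assumes "closed K" "convex K" "bounded K"
  shows "compact (blinfun_apply \<iota> ` K)"
  unfolding compact_eq_seq_compact_metric
proof (rule seq_compactI)
  fix f :: "nat \<Rightarrow> 'h" assume "\<forall>n. f n \<in> blinfun_apply \<iota> ` K"
  then have "\<forall>n. \<exists>x. x \<in> K \<and> f n = \<iota> x" by blast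
  then obtain y where y: "\<And>n. y n \<in> K" "\<And>n. f n = \<iota> (y n)" by metis
  have "bounded (range y)" by (rule bounded_subset[OF assms(3)]) (use y in auto)
  then obtain r v where "strict_mono r" "(\<lambda>n. \<iota> (y (r n))) \<longlonglongrightarrow> \<iota> v" "v \<in> K"
    using weakly_convergent_subsequence[of y] assms y(1) by metis
  then show "\<exists>l\<in>blinfun_apply \<iota> ` K. \<exists>r. strict_mono r \<and> (f \<circ> r) \<longlonglongrightarrow> l"
    using y(2) by (auto simp: o_def)
qed

end

section \<open>Almost stationary points of a penalised problem\<close>

lemma weak_tendsto_pairing:
  fixes g :: "nat \<Rightarrow> 'v::real_normed_vector \<Rightarrow>\<^sub>L real"
  assumes "g \<longlonglongrightarrow> l" "weak_tendsto y v sequentially" "bounded (range y)"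
  shows "(\<lambda>n. g n (y n)) \<longlonglongrightarrow> l v"
proof -
  obtain R where R: "\<And>n. norm (y n) \<le> R" using assms(3) by (auto simp: bounded_iff)
  have "(\<lambda>n. (g n - l) (y n)) \<longlonglongrightarrow> 0"
  proof (rule Lim_null_comparison)
    show "\<forall>\<^sub>F n in sequentially. norm ((g n - l) (y n)) \<le> norm (g n - l) * R"
    proof (intro always_eventually allI)
      fix n
      have "\<bar>(g n - l) (y n)\<bar> \<le> norm (g n - l) * norm (y n)"
        using norm_blinfun[of "g n - l" "y n"] by simp
      also have "\<dots> \<le> norm (g n - l) * R" using R by (intro mult_left_mono) auto
      finally show "norm ((g n - l) (y n)) \<le> norm (g n - l) * R" by simp
    qed
    have "(\<lambda>n. norm (g n - l) * R) \<longlonglongrightarrow> norm (l - l) * R" by (intro tendsto_intros assms)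
    then show "(\<lambda>n. norm (g n - l) * R) \<longlonglongrightarrow> 0" by simp
  qed
  moreover have "(\<lambda>n. l (y n)) \<longlonglongrightarrow> l v" using assms(2) by (auto simp: weak_tendsto_def)
  ultimately show ?thesis using tendsto_add by (fastforce simp: blinfun.bilinear_simps)
qed

lemma has_derivative_quadratic:
  fixes J :: "('v::real_normed_vector \<Rightarrow>\<^sub>L real) \<Rightarrow>\<^sub>L 'v"
  assumes sym: "\<And>g h. blinfun_apply g (J h) = blinfun_apply h (J g)"
    and R: "(R has_derivative R') (at a)"
  shows "((\<lambda>z. blinfun_apply (R z) (J (R z))) has_derivative (\<lambda>x. 2 * blinfun_apply (R' x) (J (R a)))) (at a)"
proof -
  have "((\<lambda>z. J (R z)) has_derivative (\<lambda>x. J (R' x))) (at a)"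
    using R by (intro bounded_linear.has_derivative[OF blinfun.bounded_linear_right])
  from bounded_bilinear.FDERIV[OF bounded_bilinear_blinfun_apply R this]
  show ?thesis by (rule has_derivative_eq_rhs) (simp add: sym fun_eq_iff)
qed

text \<open>Turns the perturbed minimality of Ekeland's principle along a ray into a derivative
  inequality with the same slack.\<close>

lemma derivative_lower_bound:
  fixes f :: "'a::real_normed_vector \<Rightarrow> real"
  assumes f: "(f has_derivative D) (at a)" and "s > 0"
    and ge: "\<And>t. 0 < t \<Longrightarrow> t \<le> s \<Longrightarrow> f a \<le> f (a + t *\<^sub>R x) + e * t"
  shows "- e \<le> D x"
proof -
  have lin: "linear D" using f has_derivative_linear by blast
  have "((\<lambda>t. a + t *\<^sub>R x) has_derivative (\<lambda>t. t *\<^sub>R x)) (at 0)"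
    by (auto intro!: derivative_eq_intros)
  then have "((\<lambda>t. f (a + t *\<^sub>R x)) has_derivative (\<lambda>t. D (t *\<^sub>R x))) (at 0)"
    using has_derivative_compose[of "\<lambda>t. a + t *\<^sub>R x" _ 0 UNIV f D] f by simp
  then have "((\<lambda>t. f (a + t *\<^sub>R x)) has_real_derivative D x) (at 0)"
    unfolding has_field_derivative_def
    by (rule has_derivative_eq_rhs) (simp add: linear_scale[OF lin] fun_eq_iff)
  then have "((\<lambda>t. (f (a + t *\<^sub>R x) - f a) / t) \<longlongrightarrow> D x) (at_right 0)"
    by (simp add: DERIV_def filterlim_at_split)
  moreover have "\<forall>\<^sub>F t in at_right 0. - e \<le> (f (a + t *\<^sub>R x) - f a) / t"
    unfolding eventually_at_right_field using \<open>s > 0\<close> ge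
    by (intro exI[of _ s]) (force simp: field_simps)
  ultimately show ?thesis by (rule tendsto_lowerbound) simp
qed

text \<open>Ekeland's principle is applied on \<open>B \<times> U\<close> to the cost plus
  \<open>N(r) / (2 * \<tau>)\<close> for the residual \<open>r = G y - L u\<close>. The derivative
  of \<open>N\<close> in direction \<open>r'\<close> is \<open>2 * r' (J r)\<close>, so the residual
  enters the stationarity conditions only through \<open>p = J r / \<tau>\<close>. Interior points
  \<open>y\<close> allow all directions, convexity of \<open>U\<close> those towards its
  points.\<close>

lemma penalised_stationary_point:
  fixes J :: "('v::banach \<Rightarrow>\<^sub>L real) \<Rightarrow>\<^sub>L 'v" and G :: "'v \<Rightarrow> 'v \<Rightarrow>\<^sub>L real"
    and L :: "'u::{real_normed_vector, complete_space} \<Rightarrow>\<^sub>L 'v \<Rightarrow>\<^sub>L real" and cy :: "'v \<Rightarrow> real" and cu :: "'u \<Rightarrow> real"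
  assumes sym: "\<And>g h. blinfun_apply g (J h) = blinfun_apply h (J g)"
    and pos: "\<And>g. 0 \<le> blinfun_apply g (J g)"
    and c: "\<And>y. y \<in> B \<Longrightarrow> 0 \<le> cy y" "\<And>u. u \<in> U \<Longrightarrow> 0 \<le> cu u"
    and B: "closed B" and U: "closed U" "convex U"
    and cy: "\<And>y. y \<in> B \<Longrightarrow> (cy has_derivative dcy y) (at y)"
    and cu: "\<And>u. (cu has_derivative dcu u) (at u)"
    and G: "\<And>y. y \<in> B \<Longrightarrow> (G has_derivative dG y) (at y)"
    and 0: "yi \<in> B" "ui \<in> U" and "e > 0" "\<tau> > 0"
  shows "\<exists>y\<in>B. \<exists>u\<in>U. \<exists>p. p = (1 / \<tau>) *\<^sub>R J (G y - L u) \<and>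
    cy y + cu u + blinfun_apply (G y - L u) (J (G y - L u)) / (2 * \<tau>)
      \<le> cy yi + cu ui + blinfun_apply (G yi - L ui) (J (G yi - L ui)) / (2 * \<tau>) \<and>
    (y \<in> interior B \<longrightarrow> (\<forall>x. - e * norm x \<le> dcy y x + blinfun_apply (dG y x) p)) \<and>
    (\<forall>v\<in>U. - e * norm (v - u) \<le> dcu u (v - u) - L (v - u) p)"
proof -
  define N where "N = (\<lambda>g. blinfun_apply g (J g) / (2 * \<tau>))"
  define f where "f = (\<lambda>z. cy (fst z) + cu (snd z) + N (G (fst z) - L (snd z)))"
  have cont: "continuous_on B cy" "continuous_on B G" "continuous_on U cu"
    using cy cu G by (auto intro!: continuous_at_imp_continuous_on has_derivative_continuous)
  have "continuous_on (B \<times> U) f"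
    unfolding f_def N_def using \<open>\<tau> > 0\<close>
    by (intro continuous_intros continuous_on_compose2[OF cont(1)] continuous_on_compose2[OF cont(2)]
        continuous_on_compose2[OF cont(3)]) auto
  moreover have "0 \<le> f z" if "z \<in> B \<times> U" for z
    unfolding f_def N_def using c(1)[of "fst z"] c(2)[of "snd z"] pos \<open>\<tau> > 0\<close> that by auto
  moreover have "closed (B \<times> U)" using B U by (simp add: closed_Times)
  ultimately have "\<exists>z\<in>B \<times> U. f z \<le> f (yi, ui) \<and> (\<forall>w\<in>B \<times> U. f z \<le> f w + e * dist z w)"
    using 0 \<open>e > 0\<close> by (intro ekeland) auto
  then obtain y u where yu: "y \<in> B" "u \<in> U" "f (y, u) \<le> f (yi, ui)"
      "\<And>y' u'. y' \<in> B \<Longrightarrow> u' \<in> U \<Longrightarrow> f (y, u) \<le> f (y', u') + e * dist (y, u) (y', u')" by auto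
  define p where "p = (1 / \<tau>) *\<^sub>R J (G y - L u)"
  have "- e * norm x \<le> dcy y x + dG y x p" if int: "y \<in> interior B" for x
  proof -
    have "((\<lambda>y. G y - L u) has_derivative dG y) (at y)"
      using G[OF yu(1)] by (auto intro!: derivative_eq_intros)
    from has_derivative_add[OF has_derivative_add[OF cy[OF yu(1)] has_derivative_const]
        bounded_linear.has_derivative[OF bounded_linear_divide[of "2 * \<tau>"] has_derivative_quadratic[OF sym this]]]
    have "((\<lambda>y. f (y, u)) has_derivative (\<lambda>x. dcy y x + dG y x p)) (at y)"
      unfolding f_def N_def fst_conv snd_conv p_def
      by (rule has_derivative_eq_rhs) (simp add: fun_eq_iff blinfun.scaleR_right)
    moreover obtain d where d: "d > 0" "cball y d \<subseteq> B" using int unfolding mem_interior_cball by blast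
    \<comment> \<open>The step length \<open>d / (norm x + 1)\<close> keeps the segment in
      \<open>B\<close>; the \<open>+ 1\<close> covers \<open>x = 0\<close>.\<close>
    have "f (y, u) \<le> f (y + t *\<^sub>R x, u) + e * norm x * t" if "0 < t" "t \<le> d / (norm x + 1)" for t
    proof -
      have "t * norm x \<le> t * (norm x + 1)" using that by simp
      also have "\<dots> \<le> d" using that by (simp add: pos_le_divide_eq add_nonneg_pos)
      finally have "y + t *\<^sub>R x \<in> B" using that d(2) by (auto simp: dist_norm)
      from yu(4)[OF this yu(2)] show ?thesis
        using that by (simp add: dist_Pair_Pair dist_norm ac_simps)
    qed
    ultimately show ?thesis
      using derivative_lower_bound[of "\<lambda>y. f (y, u)" _ y "d / (norm x + 1)" x "e * norm x"] d(1)
      by (simp add: add_nonneg_pos)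
  qed
  moreover have "- e * norm (v - u) \<le> dcu u (v - u) - L (v - u) p" if v: "v \<in> U" for v
  proof -
    have "((\<lambda>u. G y - L u) has_derivative (\<lambda>x. - L x)) (at u)"
      by (auto intro!: derivative_eq_intros)
    from has_derivative_add[OF has_derivative_add[OF has_derivative_const cu]
        bounded_linear.has_derivative[OF bounded_linear_divide[of "2 * \<tau>"] has_derivative_quadratic[OF sym this]]]
    have "((\<lambda>u. f (y, u)) has_derivative (\<lambda>x. dcu u x - L x p)) (at u)"
      unfolding f_def N_def fst_conv snd_conv p_def
      by (rule has_derivative_eq_rhs) (use \<open>\<tau> > 0\<close> in \<open>simp add: fun_eq_iff blinfun.bilinear_simps field_simps\<close>)
    moreover have "f (y, u) \<le> f (y, u + t *\<^sub>R (v - u)) + e * norm (v - u) * t" if t: "0 < t" "t \<le> 1" for t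
    proof -
      have "(1 - t) *\<^sub>R u + t *\<^sub>R v \<in> U" using U(2) yu(2) v t by (auto simp: convex_alt)
      then have "u + t *\<^sub>R (v - u) \<in> U" by (simp add: algebra_simps)
      from yu(4)[OF yu(1) this] show ?thesis
        using t by (simp add: dist_Pair_Pair dist_norm ac_simps)
    qed
    ultimately show ?thesis
      using derivative_lower_bound[of "\<lambda>u. f (y, u)" _ u 1 "v - u" "e * norm (v - u)"] by simp
  qed
  ultimately show ?thesis using yu unfolding f_def N_def p_def by auto
qed

section \<open>Penalties for the negative cone\<close>

text \<open>Monotonicity makes \<open>M i w (w - v)\<close> nonnegative for
  \<open>v \<le> 0\<close>, so all these numbers vanish together with their sum. Comparing
  \<open>v\<close> with 0 shows that \<open>M i w\<close> vanishes on the negative cone, which spans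
  the space because \<open>x = (x - sup 0 x) - (- sup 0 x)\<close>. Hence no cancellation occurs in
  sums of penalties.\<close>

lemma monotone_sum_eq_zero:
  fixes M :: "'i \<Rightarrow> 'v::{real_normed_vector, ordered_real_vector, lattice} \<Rightarrow> 'v \<Rightarrow>\<^sub>L real"
  assumes D: "finite D"
    and zero: "\<And>i v. i \<in> D \<Longrightarrow> v \<le> 0 \<Longrightarrow> M i v = 0"
    and mono: "\<And>i u v. i \<in> D \<Longrightarrow> 0 \<le> (M i u - M i v) (u - v)"
    and sum: "(\<Sum>i\<in>D. M i w) = 0" and i: "i \<in> D"
  shows "M i w = 0"
proof -
  have eq: "M i w (w - v) = 0" if v: "v \<le> 0" for v
  proof -
    have nonneg: "0 \<le> M j w (w - v)" if "j \<in> D" for j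
      using mono[OF that, of w v] zero[OF that v] by simp
    have "(\<Sum>j\<in>D. M j w (w - v)) = 0"
      using arg_cong[OF sum, of "\<lambda>g. blinfun_apply g (w - v)"] by (simp add: blinfun.sum_left)
    then show ?thesis
      using sum_nonneg_eq_0_iff[OF D, of "\<lambda>j. M j w (w - v)"] nonneg i by simp
  qed
  have neg: "M i w v = 0" if "v \<le> 0" for v
    using eq[OF that] eq[of 0] by (simp add: blinfun.bilinear_simps)
  show ?thesis
  proof (rule blinfun_eqI)
    fix x
    have "M i w (- sup 0 x) = 0" "M i w (x - sup 0 x) = 0"
      by (intro neg; simp)+
    then show "M i w x = (0 :: 'v \<Rightarrow>\<^sub>L real) x" by (simp add: blinfun.bilinear_simps)
  qed
qed

locale ordered_embedding = coercive_embedding \<iota> A C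
  for \<iota> :: "'v::{banach, ordered_real_vector, lattice} \<Rightarrow>\<^sub>L 'h::{real_inner, complete_space}"
    and A :: "'v \<Rightarrow>\<^sub>L 'v \<Rightarrow>\<^sub>L real" and C :: real +
  assumes closed_cone: "closed {v::'v. 0 \<le> v}"
begin

lemma closed_nonpos: "closed {v::'v. v \<le> 0}"
proof -
  have "{v::'v. v \<le> 0} = uminus -` {v. 0 \<le> v}" by auto
  then show ?thesis using closed_vimage[OF closed_cone continuous_on_minus[OF continuous_on_id]] by simp
qed

lemma convex_nonpos: "convex {v::'v. v \<le> 0}"
proof (rule convexI)
  fix x y :: 'v and s t :: real assume "x \<in> {v. v \<le> 0}" "y \<in> {v. v \<le> 0}" "0 \<le> s" "0 \<le> t"
  then have "s *\<^sub>R x \<le> 0" "t *\<^sub>R y \<le> 0" by (auto simp: scaleR_nonneg_nonpos)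
  then show "s *\<^sub>R x + t *\<^sub>R y \<in> {v. v \<le> 0}" by (simp add: add_nonpos_nonpos)
qed

text \<open>The intersection with a ball makes this set compact in \<open>H\<close>. The distance to
  it measures the violation of \<open>w \<le> 0\<close> and is continuous in
  \<open>H\<close>.\<close>

definition nonpos_image :: "real \<Rightarrow> 'h set" where
  "nonpos_image R = blinfun_apply \<iota> ` (cball 0 R \<inter> {v. v \<le> 0})"

lemma compact_nonpos_image: "compact (nonpos_image R)"
  unfolding nonpos_image_def
  by (intro compact_embedding_image closed_Int closed_nonpos convex_Int convex_nonpos) auto

text \<open>The images of points of the ball at distance at least \<open>\<eta>\<close> form a
  compact set in \<open>H\<close>, and by \<open>detect\<close> the open sets where
  \<open>m \<rho>\<close> is nonzero cover it. The sum over a finite subcover has no zero there,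
  since cancellation is excluded, so its norm has a positive minimum.\<close>

lemma penalty_detects_distance:
  fixes m :: "real \<Rightarrow> 'h \<Rightarrow> 'v \<Rightarrow>\<^sub>L real"
  assumes zero: "\<And>\<rho> v. \<rho> > 0 \<Longrightarrow> v \<le> 0 \<Longrightarrow> m \<rho> (\<iota> v) = 0"
    and mono: "\<And>\<rho> u v. \<rho> > 0 \<Longrightarrow> 0 \<le> (m \<rho> (\<iota> u) - m \<rho> (\<iota> v)) (u - v)"
    and cont: "\<And>\<rho>. \<rho> > 0 \<Longrightarrow> continuous_on UNIV (m \<rho>)"
    and detect: "\<And>z. (\<And>\<rho>. \<rho> > 0 \<Longrightarrow> m \<rho> (\<iota> z) = 0) \<Longrightarrow> z \<le> 0"
    and "\<eta> > 0"
  shows "\<exists>D c. finite D \<and> D \<subseteq> {0<..} \<and> c > 0 \<and>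
    (\<forall>w. norm w \<le> R \<longrightarrow> \<eta> \<le> infdist (\<iota> w) (nonpos_image R) \<longrightarrow> c \<le> norm (\<Sum>\<rho>\<in>D. m \<rho> (\<iota> w)))"
proof -
  define X where "X = blinfun_apply \<iota> ` cball 0 R \<inter> {h. \<eta> \<le> infdist h (nonpos_image R)}"
  have X: "compact X"
    unfolding X_def
    by (intro compact_Int_closed compact_embedding_image closed_Collect_le continuous_intros) auto
  have cover: "X \<subseteq> (\<Union>\<rho>\<in>{0<..}. {h. m \<rho> h \<noteq> 0})"
  proof
    fix h assume h: "h \<in> X"
    then obtain w where w: "h = \<iota> w" "norm w \<le> R" by (auto simp: X_def)
    have "\<not> w \<le> 0"
    proof
      assume "w \<le> 0"
      then have "h \<in> nonpos_image R" using w by (auto simp: nonpos_image_def)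
      then show False using h \<open>\<eta> > 0\<close> by (simp add: X_def)
    qed
    then show "h \<in> (\<Union>\<rho>\<in>{0<..}. {h. m \<rho> h \<noteq> 0})" using detect[of w] w(1) by auto
  qed
  have "open {h. m \<rho> h \<noteq> 0}" if "\<rho> \<in> {0<..}" for \<rho>
    using cont[of \<rho>] that by (intro open_Collect_neq continuous_intros) auto
  then obtain D where D: "D \<subseteq> {0<..}" "finite D" "X \<subseteq> (\<Union>\<rho>\<in>D. {h. m \<rho> h \<noteq> 0})"
    using compactE_image[OF X _ cover] by metis
  define M where "M = (\<lambda>h. \<Sum>\<rho>\<in>D. m \<rho> h)"
  have nz: "M h \<noteq> 0" if h: "h \<in> X" for h
  proof
    assume "M h = 0"
    obtain w where w: "h = \<iota> w" using h by (auto simp: X_def)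
    obtain \<rho> where \<rho>: "\<rho> \<in> D" "m \<rho> h \<noteq> 0" using D(3) h by auto
    have "m \<rho> (\<iota> w) = 0"
      by (rule monotone_sum_eq_zero[of D "\<lambda>\<rho> v. m \<rho> (\<iota> v)"])
        (use D \<rho> w \<open>M h = 0\<close> zero mono in \<open>auto simp: M_def\<close>)
    then show False using \<rho> w by simp
  qed
  have cM: "continuous_on X (\<lambda>h. norm (M h))"
    unfolding M_def using D cont by (intro continuous_intros continuous_on_subset[OF cont]) auto
  have "\<exists>c>0. \<forall>h\<in>X. c \<le> norm (M h)"
  proof (cases "X = {}")
    case False
    then obtain h where "h \<in> X" "\<And>k. k \<in> X \<Longrightarrow> norm (M h) \<le> norm (M k)"
      using continuous_attains_inf[OF X False cM] by blast
    then show ?thesis using nz by (intro exI[of _ "norm (M h)"]) auto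
  qed (auto intro: exI[of _ 1])
  then obtain c where c: "c > 0" "\<And>h. h \<in> X \<Longrightarrow> c \<le> norm (M h)" by blast
  show ?thesis
    using D c by (intro exI[of _ D] exI[of _ c]) (auto simp: X_def M_def)
qed

text \<open>The finite sums for \<open>\<eta> = 1 / (n + 1)\<close> are scaled up so that mere
  boundedness of \<open>P (r n) (w n)\<close> forces the distances of \<open>\<iota> (w n)\<close>
  to the negative cone to 0.\<close>

lemma penalty_sequence:
  fixes m :: "real \<Rightarrow> 'h \<Rightarrow> 'v \<Rightarrow>\<^sub>L real"
  assumes zero: "\<And>\<rho> v. \<rho> > 0 \<Longrightarrow> v \<le> 0 \<Longrightarrow> m \<rho> (\<iota> v) = 0"
    and mono: "\<And>\<rho> u v. \<rho> > 0 \<Longrightarrow> 0 \<le> (m \<rho> (\<iota> u) - m \<rho> (\<iota> v)) (u - v)"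
    and cont: "\<And>\<rho>. \<rho> > 0 \<Longrightarrow> continuous_on UNIV (m \<rho>)"
    and detect: "\<And>z. (\<And>\<rho>. \<rho> > 0 \<Longrightarrow> m \<rho> (\<iota> z) = 0) \<Longrightarrow> z \<le> 0"
    and diff: "\<And>\<rho> x. \<rho> > 0 \<Longrightarrow> (\<lambda>v. m \<rho> (\<iota> v)) differentiable (at x)"
  obtains P :: "nat \<Rightarrow> 'v \<Rightarrow> 'v \<Rightarrow>\<^sub>L real" where
    "\<And>n v. v \<le> 0 \<Longrightarrow> P n v = 0"
    "\<And>n u v. 0 \<le> (P n u - P n v) (u - v)"
    "\<And>n x. P n differentiable (at x)"
    "\<And>r w wb B. strict_mono r \<Longrightarrow> (\<And>n. norm (w n) \<le> R) \<Longrightarrow> (\<And>n. norm (P (r n) (w n)) \<le> B) \<Longrightarrow>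
      (\<lambda>n. \<iota> (w n)) \<longlonglongrightarrow> \<iota> wb \<Longrightarrow> wb \<le> 0"
proof -
  have "\<forall>n. \<exists>D c. finite D \<and> D \<subseteq> {0<..} \<and> c > 0 \<and>
    (\<forall>w. norm w \<le> R \<longrightarrow> 1 / real (Suc n) \<le> infdist (\<iota> w) (nonpos_image R) \<longrightarrow>
      c \<le> norm (\<Sum>\<rho>\<in>D. m \<rho> (\<iota> w)))"
    using penalty_detects_distance[where m = m, OF zero mono cont detect] by simp
  then obtain D where "\<forall>n. \<exists>c. finite (D n) \<and> D n \<subseteq> {0<..} \<and> c > 0 \<and>
    (\<forall>w. norm w \<le> R \<longrightarrow> 1 / real (Suc n) \<le> infdist (\<iota> w) (nonpos_image R) \<longrightarrow>
      c \<le> norm (\<Sum>\<rho>\<in>D n. m \<rho> (\<iota> w)))"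
    unfolding choice_iff by blast
  then obtain c where Dc: "\<forall>n. finite (D n) \<and> D n \<subseteq> {0<..} \<and> c n > 0 \<and>
    (\<forall>w. norm w \<le> R \<longrightarrow> 1 / real (Suc n) \<le> infdist (\<iota> w) (nonpos_image R) \<longrightarrow>
      c n \<le> norm (\<Sum>\<rho>\<in>D n. m \<rho> (\<iota> w)))"
    unfolding choice_iff by blast
  have fin: "\<And>n. finite (D n)" and pos: "\<And>n \<rho>. \<rho> \<in> D n \<Longrightarrow> \<rho> > 0" and c: "\<And>n. c n > 0"
    and big: "\<And>n w. norm w \<le> R \<Longrightarrow> 1 / real (Suc n) \<le> infdist (\<iota> w) (nonpos_image R) \<Longrightarrow>
      c n \<le> norm (\<Sum>\<rho>\<in>D n. m \<rho> (\<iota> w))"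
    using Dc by auto
  \<comment> \<open>At distance at least \<open>1 / (n + 1)\<close> the sum has norm at least
    \<open>c n\<close>, so this factor makes the norm of \<open>P n\<close> at least
    \<open>n + 1\<close> there.\<close>
  define P where "P = (\<lambda>n v. (real (Suc n) / c n) *\<^sub>R (\<Sum>\<rho>\<in>D n. m \<rho> (\<iota> v)))"
  show thesis
  proof (rule that[of P])
    fix n v assume "v \<le> (0 :: 'v)"
    then show "P n v = 0" using zero pos by (simp add: P_def)
  next
    fix n u v
    have "(P n u - P n v) (u - v) = (real (Suc n) / c n) * (\<Sum>\<rho>\<in>D n. (m \<rho> (\<iota> u) - m \<rho> (\<iota> v)) (u - v))"
      unfolding P_def
      by (simp add: blinfun.bilinear_simps blinfun.sum_left sum_subtractf right_diff_distrib diff_divide_distrib)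
    also have "\<dots> \<ge> 0"
      using c[of n] mono pos by (intro mult_nonneg_nonneg sum_nonneg) auto
    finally show "0 \<le> (P n u - P n v) (u - v)" .
  next
    fix n x
    show "P n differentiable (at x)"
      unfolding P_def
      by (intro differentiable_scaleR differentiable_const differentiable_sum fin ballI diff pos)
  next
    fix r :: "nat \<Rightarrow> nat" and w wb B
    assume r: "strict_mono r" and w: "\<And>n. norm (w n) \<le> R" "(\<lambda>n. \<iota> (w n)) \<longlonglongrightarrow> \<iota> wb"
      and B: "\<And>n. norm (P (r n) (w n)) \<le> B"
    have small: "infdist (\<iota> (w n)) (nonpos_image R) \<le> 1 / real (Suc n)" if n: "B \<le> real n" for n
    proof (rule ccontr)
      assume "\<not> ?thesis"
      moreover have "1 / real (Suc (r n)) \<le> 1 / real (Suc n)"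
        using seq_suble[OF r, of n] by (simp add: frac_le)
      ultimately have "c (r n) \<le> norm (\<Sum>\<rho>\<in>D (r n). m \<rho> (\<iota> (w n)))" by (intro big w) simp
      moreover have "norm (P (r n) (w n)) = real (Suc (r n)) / c (r n) * norm (\<Sum>\<rho>\<in>D (r n). m \<rho> (\<iota> (w n)))"
        using c[of "r n"] by (simp add: P_def)
      ultimately have "real (Suc (r n)) \<le> norm (P (r n) (w n))"
        using c[of "r n"] mult_left_mono[of 1 "norm (\<Sum>\<rho>\<in>D (r n). m \<rho> (\<iota> (w n))) / c (r n)" "real (Suc (r n))"]
        by (simp add: pos_le_divide_eq)
      then show False using B[of n] n seq_suble[OF r, of n] by simp
    qed
    have "(\<lambda>n. infdist (\<iota> (w n)) (nonpos_image R)) \<longlonglongrightarrow> infdist (\<iota> wb) (nonpos_image R)"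
      by (intro tendsto_infdist w)
    moreover have "(\<lambda>n. 1 / real (Suc n)) \<longlonglongrightarrow> 0" by (rule LIMSEQ_Suc[OF lim_const_over_n])
    moreover have "\<exists>N. \<forall>n\<ge>N. infdist (\<iota> (w n)) (nonpos_image R) \<le> 1 / real (Suc n)"
      using small by (intro exI[of _ "nat \<lceil>B\<rceil>"]) (auto simp: nat_le_iff ceiling_le_iff)
    ultimately have "infdist (\<iota> wb) (nonpos_image R) \<le> 0" by (rule LIMSEQ_le)
    then have "infdist (\<iota> wb) (nonpos_image R) = 0" using infdist_nonneg by (metis order_antisym)
    \<comment> \<open>\<open>infdist\<close> to the empty set is 0 by convention, so distance 0
      yields membership only for a nonempty set. \<open>R\<close> is nonnegative as it bounds a
      norm.\<close>
    moreover have "0 \<in> nonpos_image R"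
      unfolding nonpos_image_def using order_trans[OF norm_ge_zero w(1)[of 0]]
      by (intro image_eqI[of _ _ 0]) auto
    ultimately have "\<iota> wb \<in> nonpos_image R"
      using in_closed_iff_infdist_zero compact_imp_closed[OF compact_nonpos_image] by blast
    then obtain w' where "\<iota> wb = \<iota> w'" "w' \<le> 0" by (auto simp: nonpos_image_def)
    then show "wb \<le> 0" using injD[OF inj_\<iota>, of wb w'] by simp
  qed
qed

end

section \<open>Penalised quasi-variational inequalities\<close>

text \<open>With the derivative frozen at \<open>y0\<close>, the hypotheses give
  \<open>A x (T x) \<ge> a * (norm (T x))^2\<close> and
  \<open>norm (T x) \<ge> C / b * norm x\<close>. On a small ball \<open>\<Phi>\<close> differs from
  its linear part by a map of small Lipschitz constant, which costs at most half of the
  coercivity.\<close>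

lemma local_strong_monotonicity:
  fixes A :: "'v::banach \<Rightarrow>\<^sub>L 'v \<Rightarrow>\<^sub>L real" and \<Phi> :: "'v \<Rightarrow> 'v"
  assumes C: "C > 0" "\<And>u. C * (norm u)\<^sup>2 \<le> A u u"
    and "\<epsilon> > 0" and \<Phi>: "has_continuous_frechet_derivative_on \<Phi> D\<Phi> (cball y0 \<epsilon>)"
    and ab: "a > 0" "b > 0"
    and T: "\<And>x. norm (A x) \<le> b * norm ((id_blinfun - D\<Phi> y0) x)"
      "\<And>x. a * (norm ((id_blinfun - D\<Phi> y0) x))\<^sup>2 \<le> A x ((id_blinfun - D\<Phi> y0) x)"
  obtains c \<delta> l where "c > 0" "0 < \<delta>" "\<delta> \<le> \<epsilon>" "l > 0"
    "\<And>y z. y \<in> cball y0 \<delta> \<Longrightarrow> z \<in> cball y0 \<delta> \<Longrightarrow>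
      c * (norm (y - z))\<^sup>2 \<le> A (y - z) ((y - \<Phi> y) - (z - \<Phi> z))"
    "\<And>y z. y \<in> cball y0 \<delta> \<Longrightarrow> z \<in> cball y0 \<delta> \<Longrightarrow>
      norm ((y - \<Phi> y) - (z - \<Phi> z)) \<le> l * norm (y - z)"
proof -
  define T where "T = id_blinfun - D\<Phi> y0"
  define c where "c = a * (C / b)\<^sup>2 / 2"
  define \<eta> where "\<eta> = c / (norm A + 1)"
  have "c > 0" unfolding c_def
    by (intro divide_pos_pos mult_pos_pos zero_less_power ab C(1)) simp
  then have "\<eta> > 0" unfolding \<eta>_def
    by (intro divide_pos_pos add_nonneg_pos norm_ge_zero zero_less_one)
  have low: "2 * c * (norm x)\<^sup>2 \<le> A x (T x)" for x
  proof -
    have "C * (norm x)\<^sup>2 \<le> b * norm (T x) * norm x"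
    proof -
      have "A x x \<le> norm (A x) * norm x" using norm_blinfun[of "A x" x] by simp
      also have "\<dots> \<le> b * norm (T x) * norm x"
        using T(1)[of x] by (intro mult_right_mono) (auto simp: T_def)
      finally show ?thesis using C(2)[of x] by simp
    qed
    then have "C * norm x \<le> b * norm (T x)"
      by (cases "x = 0") (simp_all add: power2_eq_square)
    then have "C / b * norm x \<le> norm (T x)" using ab by (simp add: field_simps)
    moreover have "0 \<le> C / b * norm x" using ab C(1) by simp
    ultimately have "a * (C / b * norm x)\<^sup>2 \<le> a * (norm (T x))\<^sup>2"
      using mult_left_mono[OF power_mono[of "C / b * norm x" "norm (T x)" 2], of a] ab by simp
    then show ?thesis using T(2)[of x] by (simp add: c_def T_def power_mult_distrib power_divide)
  qed
  have deriv: "\<And>z. z \<in> cball y0 \<epsilon> \<Longrightarrow> (\<Phi> has_derivative D\<Phi> z) (at z)"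
    and cont: "continuous_on (cball y0 \<epsilon>) D\<Phi>"
    using \<Phi> by (auto simp: has_continuous_frechet_derivative_on_def)
  have "y0 \<in> cball y0 \<epsilon>" using \<open>\<epsilon> > 0\<close> by simp
  then obtain d where d: "d > 0" "\<And>z. z \<in> cball y0 \<epsilon> \<Longrightarrow> dist z y0 < d \<Longrightarrow> dist (D\<Phi> z) (D\<Phi> y0) < \<eta>"
    using cont[unfolded continuous_on_iff, rule_format, OF \<open>y0 \<in> cball y0 \<epsilon>\<close> \<open>\<eta> > 0\<close>] by blast
  define \<delta> where "\<delta> = min \<epsilon> (d / 2)"
  have \<delta>: "0 < \<delta>" "\<delta> \<le> \<epsilon>" using d \<open>\<epsilon> > 0\<close> by (auto simp: \<delta>_def)
  have lin: "norm ((\<Phi> y - D\<Phi> y0 y) - (\<Phi> z - D\<Phi> y0 z)) \<le> \<eta> * norm (y - z)"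
    if "y \<in> cball y0 \<delta>" "z \<in> cball y0 \<delta>" for y z
  proof (rule differentiable_bound[where f = "\<lambda>x. \<Phi> x - D\<Phi> y0 x" and f' = "\<lambda>x h. D\<Phi> x h - D\<Phi> y0 h",
        OF convex_cball _ _ that])
    fix x assume x: "x \<in> cball y0 \<delta>"
    then have "x \<in> cball y0 \<epsilon>" using \<delta> by auto
    then show "((\<lambda>x. \<Phi> x - D\<Phi> y0 x) has_derivative (\<lambda>h. D\<Phi> x h - D\<Phi> y0 h)) (at x within cball y0 \<delta>)"
      by (rule has_derivative_at_withinI[OF has_derivative_diff[OF deriv
          bounded_linear_imp_has_derivative[OF blinfun.bounded_linear_right]]])
    have "dist x y0 < d" using x d(1) by (simp add: \<delta>_def dist_commute)
    then have "norm (D\<Phi> x - D\<Phi> y0) \<le> \<eta>" using d(2)[OF \<open>x \<in> cball y0 \<epsilon>\<close>] by (simp add: dist_norm)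
    then show "onorm (\<lambda>h. D\<Phi> x h - D\<Phi> y0 h) \<le> \<eta>"
      by (simp only: norm_blinfun.rep_eq minus_blinfun.rep_eq)
  qed
  have split: "(y - \<Phi> y) - (z - \<Phi> z) = T (y - z) - ((\<Phi> y - D\<Phi> y0 y) - (\<Phi> z - D\<Phi> y0 z))" for y z
    by (simp add: T_def blinfun.diff_left blinfun.diff_right)
  show thesis
  proof (rule that[of c \<delta> "norm T + \<eta>"])
    fix y z assume yz: "y \<in> cball y0 \<delta>" "z \<in> cball y0 \<delta>"
    let ?x = "y - z" and ?r = "(\<Phi> y - D\<Phi> y0 y) - (\<Phi> z - D\<Phi> y0 z)"
    show "norm ((y - \<Phi> y) - (z - \<Phi> z)) \<le> (norm T + \<eta>) * norm (y - z)"
    proof -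
      have "norm (T ?x - ?r) \<le> norm (T ?x) + norm ?r" by (rule norm_triangle_ineq4)
      also have "\<dots> \<le> norm T * norm ?x + \<eta> * norm ?x"
        using norm_blinfun[of T ?x] lin[OF yz] by (rule add_mono)
      finally show ?thesis by (simp add: split distrib_right)
    qed
    have "\<bar>A ?x ?r\<bar> \<le> norm (A ?x) * norm ?r" using norm_blinfun[of "A ?x" ?r] by simp
    also have "\<dots> \<le> (norm A * norm ?x) * (\<eta> * norm ?x)"
      using norm_blinfun[of A ?x] lin[OF yz] by (intro mult_mono) auto
    also have "\<dots> = (norm A * \<eta>) * (norm ?x)\<^sup>2" by (simp add: power2_eq_square)
    also have "\<dots> \<le> c * (norm ?x)\<^sup>2"
    proof (rule mult_right_mono)
      have "norm A * \<eta> \<le> (norm A + 1) * \<eta>" using \<open>\<eta> > 0\<close> by (intro mult_right_mono) auto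
      also have "\<dots> = c" using add_nonneg_pos[OF norm_ge_zero[of A] zero_less_one] by (simp add: \<eta>_def)
      finally show "norm A * \<eta> \<le> c" .
    qed simp
    finally show "c * (norm (y - z))\<^sup>2 \<le> A (y - z) ((y - \<Phi> y) - (z - \<Phi> z))"
      unfolding split blinfun.diff_right[of "A ?x" "T ?x"] using low[of ?x] by linarith
  qed (use \<open>c > 0\<close> \<delta> \<open>\<eta> > 0\<close> norm_ge_zero[of T] in \<open>linarith+\<close>)
qed

lemma monotone_derivative_nonneg:
  fixes P :: "'v::real_normed_vector \<Rightarrow> 'v \<Rightarrow>\<^sub>L real"
  assumes mono: "\<And>u v. 0 \<le> (P u - P v) (u - v)" and P: "(P has_derivative P') (at w)"
  shows "0 \<le> P' x x"
proof -
  have "((\<lambda>w. P w x) has_derivative (\<lambda>h. P' h x)) (at w)"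
    by (rule bounded_linear.has_derivative[OF blinfun.bounded_linear_left P])
  moreover have "P w x \<le> P (w + t *\<^sub>R x) x + 0 * t" if "0 < t" "t \<le> 1" for t
    using mono[of "w + t *\<^sub>R x" w] that by (simp add: blinfun.bilinear_simps zero_le_mult_iff)
  ultimately have "- 0 \<le> P' x x"
    using derivative_lower_bound[of "\<lambda>w. P w x" "\<lambda>h. P' h x" w 1 x 0] by simp
  then show ?thesis by simp
qed

lemma tendsto_of_square_bound:
  fixes X :: "nat \<Rightarrow> 'a::real_normed_vector"
  assumes "\<And>n. (norm (X n - x))\<^sup>2 \<le> h n" "h \<longlonglongrightarrow> 0"
  shows "X \<longlonglongrightarrow> x"
proof -
  have "(\<lambda>n. (norm (X n - x))\<^sup>2) \<longlonglongrightarrow> 0"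
    by (rule Lim_null_comparison[OF _ assms(2)]) (simp add: assms(1))
  then have "(\<lambda>n. X n - x) \<longlonglongrightarrow> 0" by (simp add: tendsto_norm_zero_iff)
  then show ?thesis by (rule LIM_zero_cancel)
qed

lemma LIMSEQ_subsubseq:
  fixes y :: "nat \<Rightarrow> 'a::metric_space"
  assumes "\<And>r :: nat \<Rightarrow> nat. strict_mono r \<Longrightarrow> \<exists>s :: nat \<Rightarrow> nat. strict_mono s \<and> (\<lambda>n. y (r (s n))) \<longlonglongrightarrow> l"
  shows "y \<longlonglongrightarrow> l"
proof (rule tendstoI, rule ccontr)
  fix e :: real assume "e > 0" and "\<not> (\<forall>\<^sub>F n in sequentially. dist (y n) l < e)"
  then obtain r :: "nat \<Rightarrow> nat" where r: "strict_mono r" "\<And>n. \<not> dist (y (r n)) l < e"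
    using not_eventually_sequentiallyD[of "\<lambda>n. dist (y n) l < e"] by auto
  then obtain s :: "nat \<Rightarrow> nat" where "(\<lambda>n. y (r (s n))) \<longlonglongrightarrow> l" using assms[OF r(1)] by auto
  then have "\<forall>\<^sub>F n in sequentially. dist (y (r (s n))) l < e" using \<open>e > 0\<close> by (rule tendstoD)
  then show False using r(2) by simp
qed

text \<open>The quantitative facts on one ball around the reference state. The inverse of
  \<open>id_blinfun - D\<Phi> y\<close> is eliminated from the uniform bounds by writing its
  argument as \<open>(id_blinfun - D\<Phi> y) x\<close>. \<open>P_limit\<close> allows a subsequence
  \<open>r\<close> of penalties because limits are taken along subsequences.\<close>

locale penalised_qvi = ordered_embedding \<iota> A C
  for \<iota> :: "'v::{banach, ordered_real_vector, lattice} \<Rightarrow>\<^sub>L 'h::{real_inner, complete_space}"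
    and A :: "'v \<Rightarrow>\<^sub>L 'v \<Rightarrow>\<^sub>L real" and C :: real +
  fixes \<Phi> :: "'v \<Rightarrow> 'v" and D\<Phi> :: "'v \<Rightarrow> 'v \<Rightarrow>\<^sub>L 'v" and P :: "nat \<Rightarrow> 'v \<Rightarrow> 'v \<Rightarrow>\<^sub>L real"
    and ys :: 'v and \<delta> c l a b :: real
  assumes \<Phi>_cc: "completely_continuous \<Phi>"
    and const_pos: "\<delta> > 0" "c > 0" "l > 0" "a > 0" "b > 0"
    and strongly_monotone: "\<And>y z. y \<in> cball ys \<delta> \<Longrightarrow> z \<in> cball ys \<delta> \<Longrightarrow>
      c * (norm (y - z))\<^sup>2 \<le> A (y - z) ((y - \<Phi> y) - (z - \<Phi> z))"
    and lipschitz: "\<And>y z. y \<in> cball ys \<delta> \<Longrightarrow> z \<in> cball ys \<delta> \<Longrightarrow>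
      norm ((y - \<Phi> y) - (z - \<Phi> z)) \<le> l * norm (y - z)"
    and \<Phi>_derivative: "\<And>y. y \<in> cball ys \<delta> \<Longrightarrow> (\<Phi> has_derivative D\<Phi> y) (at y)"
    and D\<Phi>_continuous: "continuous_on (cball ys \<delta>) D\<Phi>"
    and bij_T: "\<And>y. y \<in> cball ys \<delta> \<Longrightarrow> bij (blinfun_apply (id_blinfun - D\<Phi> y))"
    and uniform_bound: "\<And>y x. y \<in> cball ys \<delta> \<Longrightarrow> norm (A x) \<le> b * norm ((id_blinfun - D\<Phi> y) x)"
    and uniform_coercive: "\<And>y x. y \<in> cball ys \<delta> \<Longrightarrow>
      a * (norm ((id_blinfun - D\<Phi> y) x))\<^sup>2 \<le> A x ((id_blinfun - D\<Phi> y) x)"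
    and P_zero: "\<And>n v. v \<le> 0 \<Longrightarrow> P n v = 0"
    and P_mono: "\<And>n u v. 0 \<le> (P n u - P n v) (u - v)"
    and P_differentiable: "\<And>n x. P n differentiable (at x)"
    and P_limit: "\<And>r y wb B. strict_mono r \<Longrightarrow> (\<And>n. y n \<in> cball ys \<delta>) \<Longrightarrow>
      (\<And>n. norm (P (r n) (y n - \<Phi> (y n))) \<le> B) \<Longrightarrow>
      (\<lambda>n. \<iota> (y n - \<Phi> (y n))) \<longlonglongrightarrow> \<iota> wb \<Longrightarrow> wb \<le> 0"
begin

text \<open>Each inequality is tested with its own obstacle plus the other solution's nonpositive
  \<open>z - \<Phi> z\<close>. In the sum \<open>g\<close> cancels, and strong monotonicity
  applies.\<close>

lemma qvi_solution_unique:
  assumes y: "y \<in> cball ys \<delta>" "y \<in> qvi_solutions A \<Phi> g"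
    and z: "z \<in> cball ys \<delta>" "z \<in> qvi_solutions A \<Phi> g"
  shows "y = z"
proof -
  have "\<Phi> y + (z - \<Phi> z) \<le> \<Phi> y" "\<Phi> z + (y - \<Phi> y) \<le> \<Phi> z"
    using y(2) z(2) by (auto simp: qvi_solutions_def)
  then have "(A y - g) (y - (\<Phi> y + (z - \<Phi> z))) \<le> 0" "(A z - g) (z - (\<Phi> z + (y - \<Phi> y))) \<le> 0"
    using y(2) z(2) unfolding qvi_solutions_def by blast+
  then have "A (y - z) ((y - \<Phi> y) - (z - \<Phi> z)) \<le> 0" by (simp add: blinfun.bilinear_simps)
  then have "c * (norm (y - z))\<^sup>2 \<le> 0" using strongly_monotone[OF y(1) z(1)] by linarith
  then show ?thesis using const_pos by (simp add: mult_le_0_iff)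
qed

text \<open>Complete continuity makes \<open>\<Phi> (y n)\<close> converge strongly along a weakly
  convergent subsequence. The equation bounds the penalty term, so the weak limit is feasible, and
  strong monotonicity upgrades the convergence of \<open>y\<close> to strong convergence.\<close>

lemma penalised_limit:
  assumes r: "strict_mono r" and y: "\<And>n. y n \<in> cball ys \<delta>" and g: "g \<longlonglongrightarrow> gl"
    and eq: "\<And>n. A (y n) + P (r n) (y n - \<Phi> (y n)) = g n"
  shows "\<exists>s yb. strict_mono s \<and> (\<lambda>n. y (s n)) \<longlonglongrightarrow> yb \<and> yb \<in> cball ys \<delta> \<and> yb \<in> qvi_solutions A \<Phi> gl"
proof -
  have bdd: "bounded (range y)" by (rule bounded_subset[OF bounded_cball[of ys \<delta>]]) (use y in auto)
  obtain s yb where s: "strict_mono s" and weak: "weak_tendsto (\<lambda>n. y (s n)) yb sequentially"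
      and \<iota>y: "(\<lambda>n. \<iota> (y (s n))) \<longlonglongrightarrow> \<iota> yb" and yb: "yb \<in> cball ys \<delta>"
    using weakly_convergent_subsequence[OF bdd] y by (metis closed_cball convex_cball)
  define w where "w = (\<lambda>n. y (s n) - \<Phi> (y (s n)))"
  define wb where "wb = yb - \<Phi> yb"
  have \<Phi>y: "(\<lambda>n. \<Phi> (y (s n))) \<longlonglongrightarrow> \<Phi> yb"
    using \<Phi>_cc weak by (auto simp: completely_continuous_def)
  have w_weak: "weak_tendsto w wb sequentially"
    unfolding weak_tendsto_def
  proof
    fix f :: "'v \<Rightarrow>\<^sub>L real"
    have "(\<lambda>n. f (y (s n))) \<longlonglongrightarrow> f yb" using weak by (simp add: weak_tendsto_def)
    then have "(\<lambda>n. f (y (s n)) - f (\<Phi> (y (s n)))) \<longlonglongrightarrow> f yb - f (\<Phi> yb)"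
      by (rule tendsto_diff[OF _ blinfun.tendsto[OF tendsto_const \<Phi>y]])
    then show "(\<lambda>n. f (w n)) \<longlonglongrightarrow> f wb" by (simp add: w_def wb_def blinfun.diff_right)
  qed
  have gs: "(\<lambda>n. g (s n)) \<longlonglongrightarrow> gl" using LIMSEQ_subseq_LIMSEQ[OF g s] by (simp add: o_def)
  obtain B1 where B1: "\<And>n. norm (y n) \<le> B1" using bdd by (auto simp: bounded_iff)
  obtain B2 where B2: "\<And>n. norm (g n) \<le> B2"
    using convergent_imp_Bseq[OF convergentI[OF g]] by (auto simp: Bseq_def)
  have wb: "wb \<le> 0"
  proof (rule P_limit)
    show "strict_mono (r \<circ> s)" using r s by (rule strict_mono_o)
    show "y (s n) \<in> cball ys \<delta>" for n by (rule y)
    show "(\<lambda>n. \<iota> (y (s n) - \<Phi> (y (s n)))) \<longlonglongrightarrow> \<iota> wb"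
      unfolding wb_def blinfun.diff_right by (intro tendsto_diff \<iota>y blinfun.tendsto tendsto_const \<Phi>y)
    show "norm (P ((r \<circ> s) n) (y (s n) - \<Phi> (y (s n)))) \<le> B2 + norm A * B1" for n
    proof -
      have "P (r (s n)) (y (s n) - \<Phi> (y (s n))) = g (s n) - A (y (s n))"
        using eq[of "s n"] by (simp add: algebra_simps)
      moreover have "norm (A (y (s n))) \<le> norm A * B1"
        using norm_blinfun[of A "y (s n)"] mult_left_mono[OF B1[of "s n"], of "norm A"] by simp
      ultimately show ?thesis
        using norm_triangle_ineq4[of "g (s n)" "A (y (s n))"] B2[of "s n"] by simp
    qed
  qed
  \<comment> \<open>The equation replaces \<open>A (y (s n))\<close> by \<open>g (s n)\<close> minus
    the penalty. Since \<open>P\<close> vanishes at \<open>wb\<close>, it may be subtracted there,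
    and monotonicity lets the penalty difference be dropped.\<close>
  have key: "c * (norm (y (s n) - yb))\<^sup>2 \<le> (g (s n) - A yb) (w n - wb)" for n
  proof -
    have "c * (norm (y (s n) - yb))\<^sup>2 \<le> A (y (s n) - yb) (w n - wb)"
      unfolding w_def wb_def by (rule strongly_monotone[OF y yb])
    also have "A (y (s n) - yb) = g (s n) - A yb - (P (r (s n)) (w n) - P (r (s n)) wb)"
      using eq[of "s n"] P_zero[OF wb] by (simp add: w_def blinfun.diff_right algebra_simps)
    also have "(g (s n) - A yb - (P (r (s n)) (w n) - P (r (s n)) wb)) (w n - wb) \<le> (g (s n) - A yb) (w n - wb)"
      using P_mono[of "r (s n)" "w n" wb] by (simp add: blinfun.diff_left)
    finally show ?thesis .
  qed
  have strong: "(\<lambda>n. y (s n)) \<longlonglongrightarrow> yb"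
  proof -
    have "bounded (range w)"
    proof -
      have "bounded (range (\<lambda>n. y (s n)))" by (rule bounded_subset[OF bdd]) auto
      moreover have "bounded (range (\<lambda>n. \<Phi> (y (s n))))" using \<Phi>y by (rule convergent_imp_bounded)
      ultimately show ?thesis unfolding w_def by (rule bounded_minus_comp)
    qed
    moreover have "(\<lambda>n. g (s n) - A yb) \<longlonglongrightarrow> gl - A yb" by (intro tendsto_intros gs)
    ultimately have "(\<lambda>n. (g (s n) - A yb) (w n)) \<longlonglongrightarrow> (gl - A yb) wb"
      using w_weak by (intro weak_tendsto_pairing)
    then have "(\<lambda>n. (g (s n) - A yb) (w n) - (g (s n) - A yb) wb) \<longlonglongrightarrow> (gl - A yb) wb - (gl - A yb) wb"
      by (rule tendsto_diff[OF _ blinfun.tendsto[OF tendsto_diff[OF gs tendsto_const] tendsto_const]])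
    then have "(\<lambda>n. (g (s n) - A yb) (w n - wb) / c) \<longlonglongrightarrow> 0"
      by (intro tendsto_divide_zero) (simp add: blinfun.diff_right)
    moreover have "(norm (y (s n) - yb))\<^sup>2 \<le> (g (s n) - A yb) (w n - wb) / c" for n
      using key[of n] const_pos by (simp add: pos_le_divide_eq mult.commute)
    ultimately show ?thesis by (rule tendsto_of_square_bound[rotated])
  qed
  have "(A yb - gl) (yb - v) \<le> 0" if v: "v \<le> \<Phi> yb" for v
  proof -
    \<comment> \<open>Shifting by \<open>\<Phi> yb\<close> turns the solution-dependent constraint
      into the fixed cone \<open>z \<le> 0\<close>, on which every penalty vanishes.\<close>
    define z where "z = v - \<Phi> yb"
    have "z \<le> 0" using v by (simp add: z_def)
    have "0 \<le> (g (s n) - A (y (s n))) (w n - z)" for n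
    proof -
      have "g (s n) - A (y (s n)) = P (r (s n)) (w n) - P (r (s n)) z"
        using eq[of "s n"] P_zero[OF \<open>z \<le> 0\<close>] by (simp add: w_def algebra_simps)
      then show ?thesis using P_mono by simp
    qed
    moreover have "(\<lambda>n. (g (s n) - A (y (s n))) (w n - z)) \<longlonglongrightarrow> (gl - A yb) (wb - z)"
      unfolding w_def wb_def by (intro blinfun.tendsto tendsto_diff tendsto_const gs strong \<Phi>y)
    ultimately have "0 \<le> (gl - A yb) (wb - z)" by (intro LIMSEQ_le_const) auto
    then show ?thesis by (simp add: wb_def z_def blinfun.bilinear_simps)
  qed
  then have "yb \<in> qvi_solutions A \<Phi> gl" using wb by (simp add: qvi_solutions_def wb_def)
  then show ?thesis using s strong yb by blast
qed

text \<open>Coercivity of \<open>A\<close> together with the upper bound on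
  \<open>A (I - \<Phi>')^(-1)\<close> bounds the inverse of \<open>I - \<Phi>'\<close> by
  \<open>b / C\<close>.\<close>

lemma norm_inv_bound:
  assumes "y \<in> cball ys \<delta>"
  shows "norm x \<le> b / C * norm ((id_blinfun - D\<Phi> y) x)"
proof -
  have "C * (norm x)\<^sup>2 \<le> A x x" by (rule coercive)
  also have "A x x \<le> norm (A x) * norm x" using norm_blinfun[of "A x" x] by simp
  also have "\<dots> \<le> b * norm ((id_blinfun - D\<Phi> y) x) * norm x"
    using uniform_bound[OF assms] by (intro mult_right_mono) auto
  finally have "C * norm x \<le> b * norm ((id_blinfun - D\<Phi> y) x)"
    by (cases "x = 0") (simp_all add: power2_eq_square)
  then show ?thesis using C_pos by (simp add: field_simps)
qed

text \<open>Testing with \<open>- x\<close>, where \<open>p = (id_blinfun - D\<Phi> y) x\<close>,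
  turns the penalty derivative into \<open>- P' p p\<close>, which has the good sign. Coercivity
  then bounds \<open>p\<close> independently of the penalty, however stiff it is.\<close>

lemma adjoint_bound:
  assumes y: "y \<in> cball ys \<delta>" and P': "(P n has_derivative P') (at w)" and "0 \<le> K"
    and ge: "\<And>x. - K * norm x \<le> A x p + P' ((id_blinfun - D\<Phi> y) x) p"
  shows "norm p \<le> K * b / (C * a)"
proof -
  obtain x where x: "p = (id_blinfun - D\<Phi> y) x" using bij_T[OF y] by (metis bij_pointE)
  have lin: "linear P'" using P' by (rule has_derivative_linear)
  have "- K * norm x \<le> A (- x) p + P' ((id_blinfun - D\<Phi> y) (- x)) p" using ge[of "- x"] by simp
  also have "(id_blinfun - D\<Phi> y) (- x) = - p" by (simp only: x blinfun.minus_right)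
  finally have "A x p + P' p p \<le> K * norm x" by (simp add: linear_neg[OF lin] blinfun.minus_right blinfun.minus_left)
  then have "a * (norm p)\<^sup>2 \<le> K * norm x"
    using uniform_coercive[OF y, of x] monotone_derivative_nonneg[OF P_mono P', of p] by (simp flip: x)
  also have "\<dots> \<le> K * (b / C * norm p)"
    using norm_inv_bound[OF y, of x] \<open>0 \<le> K\<close> by (intro mult_left_mono) (simp_all flip: x)
  finally have "(a * norm p) * norm p \<le> (K * (b / C)) * norm p" by (simp add: power2_eq_square ac_simps)
  then have "a * norm p \<le> K * (b / C)"
    using \<open>0 \<le> K\<close> const_pos C_pos mult_right_le_imp_le[of "a * norm p" "norm p" "K * (b / C)"]
    by (cases "p = 0") simp_all
  then show ?thesis using const_pos C_pos by (simp add: field_simps)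
qed

end

lemma in_interior_cball:
  fixes x :: "'a::metric_space"
  assumes "dist y x < r"
  shows "y \<in> interior (cball x r)"
proof -
  have "y \<in> ball x r" using assms by (simp add: dist_commute)
  then show ?thesis using interior_maximal[OF ball_subset_cball[of x r] open_ball] by blast
qed

context penalised_qvi
begin

lemma has_derivative_penalised_state:
  assumes "y \<in> cball ys \<delta>"
  shows "((\<lambda>y. A y + P n (y - \<Phi> y)) has_derivative
    (\<lambda>x. A x + frechet_derivative (P n) (at (y - \<Phi> y)) ((id_blinfun - D\<Phi> y) x))) (at y)"
proof -
  have "((\<lambda>y. y - \<Phi> y) has_derivative (\<lambda>x. (id_blinfun - D\<Phi> y) x)) (at y)"
    using has_derivative_diff[OF has_derivative_ident \<Phi>_derivative[OF assms]]
    by (simp add: blinfun.diff_left)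
  then have "((\<lambda>y. P n (y - \<Phi> y)) has_derivative
      (\<lambda>x. frechet_derivative (P n) (at (y - \<Phi> y)) ((id_blinfun - D\<Phi> y) x))) (at y)"
    using has_derivative_compose[OF _ P_differentiable[unfolded frechet_derivative_works]] by blast
  then show ?thesis
    by (rule has_derivative_add[OF bounded_linear_imp_has_derivative[OF blinfun.bounded_linear_right]])
qed

lemma adjoint_bound_frechet:
  assumes y: "y \<in> cball ys \<delta>" and "0 \<le> K"
    and ge: "\<And>x. - K * norm x \<le> blinfun_apply (A x +
      frechet_derivative (P n) (at w) ((id_blinfun - D\<Phi> y) x)) p"
  shows "norm p \<le> K * b / (C * a)"
proof (rule adjoint_bound[OF y _ \<open>0 \<le> K\<close>])
  show "(P n has_derivative frechet_derivative (P n) (at w)) (at w)"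
    using P_differentiable by (simp add: frechet_derivative_works)
  show "- K * norm x \<le> A x p + (frechet_derivative (P n) (at w) ((id_blinfun - D\<Phi> y) x)) p" for x
    using ge[of x] by (simp add: blinfun.add_left)
qed

text \<open>
  The equation \<open>S\<^sub>n(y) = g - \<theta> \<xi>\<close>, with \<open>S\<^sub>n\<close> the penalised operator and \<open>\<xi> = g - A y\<^sup>*\<close>, is solved
  exactly by \<open>y\<^sup>*\<close> for \<open>\<theta> = 1\<close>. Taking \<open>\<theta> \<in> [0, 1]\<close> as a control with cost \<open>\<theta>\<close> drives it to \<open>0\<close>, since
  the multiplier of the equation is too small to balance this cost.
\<close>

lemma reference_states:
  assumes ys: "ys \<in> qvi_solutions A \<Phi> g"
  shows "\<exists>z. (\<forall>n. z n \<in> cball ys \<delta>) \<and> z \<longlonglongrightarrow> ys \<and>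
    (\<lambda>n. A (z n) + P n (z n - \<Phi> (z n)) - g) \<longlonglongrightarrow> 0"
proof -
  obtain J :: "('v \<Rightarrow>\<^sub>L real) \<Rightarrow>\<^sub>L 'v" and k
    where sym: "\<And>g h. blinfun_apply g (J h) = blinfun_apply h (J g)"
      and k: "k > 0" "\<And>g. k * (norm g)\<^sup>2 \<le> blinfun_apply g (J g)"
    using riesz_operator[OF C_pos coercive] by blast
  have pos: "0 \<le> blinfun_apply g (J g)" for g :: "'v \<Rightarrow>\<^sub>L real"
    using k(2)[of g] k(1) order_trans[of 0 "k * (norm g)\<^sup>2"] by simp
  define \<xi> where "\<xi> = g - A ys"
  define L where "L = - blinfun_scaleR_left \<xi>"
  have L: "L \<theta> = - \<theta> *\<^sub>R \<xi>" for \<theta> by (simp add: L_def blinfun.minus_left)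
  define e :: "nat \<Rightarrow> real" where "e = (\<lambda>n. 1 / real (Suc n))"
  have e: "e n > 0" "e \<longlonglongrightarrow> 0" for n
    unfolding e_def by (simp, rule LIMSEQ_Suc[OF lim_const_over_n])
  define G where "G = (\<lambda>n y. A y + P n (y - \<Phi> y) - g)"
  define dG where "dG = (\<lambda>n y x. A x + frechet_derivative (P n) (at (y - \<Phi> y)) ((id_blinfun - D\<Phi> y) x))"
  define Q where "Q = (\<lambda>n y \<theta> p. y \<in> cball ys \<delta> \<and> 0 \<le> \<theta> \<and> \<theta> \<le> 1 \<and>
    blinfun_apply (G n y - L \<theta>) (J (G n y - L \<theta>)) / (2 * e n) \<le> 1 \<and>
    (y \<in> interior (cball ys \<delta>) \<longrightarrow> (\<forall>x. - e n * norm x \<le> blinfun_apply (dG n y x) p)) \<and>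
    - e n * norm (0 - \<theta>) \<le> (0 - \<theta>) - L (0 - \<theta>) p)"
  have "\<exists>y \<theta> p. Q n y \<theta> p" for n
  proof -
    have ys0: "ys \<le> \<Phi> ys" using ys by (simp add: qvi_solutions_def)
    have "\<exists>y\<in>cball ys \<delta>. \<exists>\<theta>\<in>{0..1}. \<exists>p. p = (1 / e n) *\<^sub>R J (G n y - L \<theta>) \<and>
      0 + \<theta> + blinfun_apply (G n y - L \<theta>) (J (G n y - L \<theta>)) / (2 * e n)
        \<le> 0 + 1 + blinfun_apply (G n ys - L 1) (J (G n ys - L 1)) / (2 * e n) \<and>
      (y \<in> interior (cball ys \<delta>) \<longrightarrow> (\<forall>x. - e n * norm x \<le> 0 + blinfun_apply (dG n y x) p)) \<and>
      (\<forall>v\<in>{0..1}. - e n * norm (v - \<theta>) \<le> (v - \<theta>) - L (v - \<theta>) p)"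
    proof (rule penalised_stationary_point[where cy = "\<lambda>_. 0" and cu = "\<lambda>\<theta>. \<theta>" and dcy = "\<lambda>_ _. 0"
          and dcu = "\<lambda>_ x. x" and yi = ys and ui = 1, OF sym pos])
      show "(G n has_derivative dG n y) (at y)" if "y \<in> cball ys \<delta>" for y
        using has_derivative_diff[OF has_derivative_penalised_state[OF that] has_derivative_const]
        unfolding G_def dG_def by simp
    qed (use e const_pos in \<open>auto simp: has_derivative_ident\<close>)
    then obtain y \<theta> p where *: "y \<in> cball ys \<delta>" "\<theta> \<in> {0..1}"
        "0 + \<theta> + blinfun_apply (G n y - L \<theta>) (J (G n y - L \<theta>)) / (2 * e n)
          \<le> 0 + 1 + blinfun_apply (G n ys - L 1) (J (G n ys - L 1)) / (2 * e n)"
        "y \<in> interior (cball ys \<delta>) \<longrightarrow> (\<forall>x. - e n * norm x \<le> 0 + blinfun_apply (dG n y x) p)"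
        "\<forall>v\<in>{0..1}. - e n * norm (v - \<theta>) \<le> (v - \<theta>) - L (v - \<theta>) p" by blast
    \<comment> \<open>The penalty vanishes at the feasible \<open>ys\<close>, so the comparison
      point with control 1 has zero residual and total value 1.\<close>
    have "G n ys - L 1 = 0" using P_zero ys0 by (simp add: G_def L \<xi>_def)
    then have "blinfun_apply (G n y - L \<theta>) (J (G n y - L \<theta>)) / (2 * e n) \<le> 1"
      using *(2,3) by simp
    moreover have "- e n * norm (0 - \<theta>) \<le> (0 - \<theta>) - L (0 - \<theta>) p"
      using *(5) by (rule bspec) simp
    ultimately have "Q n y \<theta> p" unfolding Q_def using * by simp
    then show ?thesis by blast
  qed
  then obtain y \<theta> p where Q: "\<And>n. Q n (y n) (\<theta> n) (p n)" by metis
  have yB: "\<And>n. y n \<in> cball ys \<delta>" and \<theta>: "\<And>n. 0 \<le> \<theta> n" "\<And>n. \<theta> n \<le> 1"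
    using Q by (simp_all add: Q_def)
  define res where "res = (\<lambda>n. G n (y n) - L (\<theta> n))"
  have res: "res \<longlonglongrightarrow> 0"
  proof -
    have "(norm (res n))\<^sup>2 \<le> 2 * e n / k" for n
    proof -
      have "blinfun_apply (res n) (J (res n)) \<le> 2 * e n"
        using Q[of n] e(1)[of n] by (simp add: Q_def res_def pos_divide_le_eq)
      then have "k * (norm (res n))\<^sup>2 \<le> 2 * e n" using k(2)[of "res n"] by linarith
      then show ?thesis using k(1) by (simp add: pos_le_divide_eq mult.commute)
    qed
    moreover have "(\<lambda>n. 2 * e n / k) \<longlonglongrightarrow> 0" using e(2) by (intro tendsto_divide_zero tendsto_mult_right_zero)
    ultimately show ?thesis using tendsto_of_square_bound[of res 0 "\<lambda>n. 2 * e n / k"] by simp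
  qed
  have eq: "A (y n) + P n (y n - \<Phi> (y n)) = g - \<theta> n *\<^sub>R \<xi> + res n" for n
    by (simp add: res_def G_def L)
  have "y \<longlonglongrightarrow> ys"
  proof (rule LIMSEQ_subsubseq)
    fix r :: "nat \<Rightarrow> nat" assume r: "strict_mono r"
    have "compact {0..1::real}" by simp
    moreover have "\<forall>n. \<theta> (r n) \<in> {0..1}" using \<theta> by simp
    ultimately obtain \<theta>b s where s: "\<theta>b \<in> {0..1}" "strict_mono s" "(\<lambda>n. \<theta> (r (s n))) \<longlonglongrightarrow> \<theta>b"
      unfolding compact_eq_seq_compact_metric seq_compact_def o_def by meson
    have rs: "strict_mono (r \<circ> s)" using r s(2) by (rule strict_mono_o)
    have "\<exists>s' yb. strict_mono s' \<and> (\<lambda>n. y (r (s (s' n)))) \<longlonglongrightarrow> yb \<and> yb \<in> cball ys \<delta> \<and>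
        yb \<in> qvi_solutions A \<Phi> (g - \<theta>b *\<^sub>R \<xi> + 0)"
    proof (rule penalised_limit[OF rs])
      show "(\<lambda>n. g - \<theta> (r (s n)) *\<^sub>R \<xi> + res (r (s n))) \<longlonglongrightarrow> g - \<theta>b *\<^sub>R \<xi> + 0"
        using LIMSEQ_subseq_LIMSEQ[OF res rs] by (intro tendsto_intros s(3)) (simp add: o_def)
      show "A (y (r (s n))) + P ((r \<circ> s) n) (y (r (s n)) - \<Phi> (y (r (s n)))) = g - \<theta> (r (s n)) *\<^sub>R \<xi> + res (r (s n))" for n
        using eq by simp
    qed (rule yB)
    then obtain s' yb where s': "strict_mono s'" "(\<lambda>n. y (r (s (s' n)))) \<longlonglongrightarrow> yb" "yb \<in> cball ys \<delta>"
        "yb \<in> qvi_solutions A \<Phi> (g - \<theta>b *\<^sub>R \<xi>)" by auto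
    \<comment> \<open>For the data \<open>g - \<theta>b *\<^sub>R \<xi>\<close> the variational
      inequality at \<open>ys\<close> is the original one multiplied by
      \<open>1 - \<theta>b \<ge> 0\<close>. So \<open>ys\<close> solves every possible limit
      problem, and local uniqueness identifies the limit.\<close>
    have ysQ: "ys \<in> qvi_solutions A \<Phi> (g - \<theta>b *\<^sub>R \<xi>)"
      unfolding qvi_solutions_def
    proof (safe)
      show "ys \<le> \<Phi> ys" using ys by (simp add: qvi_solutions_def)
      fix v assume "v \<le> \<Phi> ys"
      then have "(A ys - g) (ys - v) \<le> 0" using ys by (simp add: qvi_solutions_def)
      moreover have "(A ys - (g - \<theta>b *\<^sub>R \<xi>)) (ys - v) = (1 - \<theta>b) * (A ys - g) (ys - v)"
        by (simp add: \<xi>_def blinfun.bilinear_simps algebra_simps)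
      ultimately show "(A ys - (g - \<theta>b *\<^sub>R \<xi>)) (ys - v) \<le> 0"
        using s(1) by (simp add: mult_nonneg_nonpos)
    qed
    have "yb = ys" using qvi_solution_unique[OF s'(3,4) _ ysQ] const_pos by simp
    then show "\<exists>s :: nat \<Rightarrow> nat. strict_mono s \<and> (\<lambda>n. y (r (s n))) \<longlonglongrightarrow> ys"
      using s' s(2) by (intro exI[of _ "s \<circ> s'"]) (auto intro: strict_mono_o)
  qed
  then have "\<forall>\<^sub>F n in sequentially. dist (y n) ys < \<delta>" using const_pos by (intro tendstoD) auto
  moreover have "\<forall>\<^sub>F n in sequentially. e n * b / (C * a) * norm \<xi> + e n < 1"
  proof -
    have "(\<lambda>n. e n * b / (C * a) * norm \<xi> + e n) \<longlonglongrightarrow> 0 * b / (C * a) * norm \<xi> + 0"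
      using C_pos const_pos by (intro tendsto_intros e) auto
    then show ?thesis by (intro order_tendstoD) auto
  qed
  ultimately have "\<forall>\<^sub>F n in sequentially. \<theta> n = 0"
  proof eventually_elim
    case (elim n)
    then have "y n \<in> interior (cball ys \<delta>)" by (intro in_interior_cball)
    then have "- e n * norm x \<le> blinfun_apply (dG n (y n) x) (p n)" for x
      using Q[of n] by (simp add: Q_def)
    then have "norm (p n) \<le> e n * b / (C * a)"
      unfolding dG_def using yB[of n] e(1)[of n] by (intro adjoint_bound_frechet[where K = "e n"]) auto
    then have "\<bar>\<xi> (p n)\<bar> \<le> e n * b / (C * a) * norm \<xi>"
      using norm_blinfun[of \<xi> "p n"] mult_left_mono[of "norm (p n)" "e n * b / (C * a)" "norm \<xi>"]
      by (simp add: mult.commute)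
    then have gt: "\<xi> (p n) + 1 - e n > 0" using elim(2) by linarith
    \<comment> \<open>Comparison with control 0 gives \<open>\<theta> n\<close> times a positive
      number at most 0; positivity comes from the smallness of \<open>p n\<close>. Hence
      \<open>\<theta> n = 0\<close> eventually.\<close>
    have "- e n * norm (0 - \<theta> n) \<le> (0 - \<theta> n) - L (0 - \<theta> n) (p n)"
      using Q[of n] unfolding Q_def by blast
    then have "\<theta> n * (\<xi> (p n) + 1 - e n) \<le> 0"
      using \<theta>(1)[of n] by (simp add: L blinfun.bilinear_simps algebra_simps)
    then show ?case using gt \<theta>(1)[of n] by (simp add: mult_le_0_iff)
  qed
  then have "\<forall>\<^sub>F n in sequentially. A (y n) + P n (y n - \<Phi> (y n)) - g = res n"
    by eventually_elim (simp add: eq)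
  then have "(\<lambda>n. A (y n) + P n (y n - \<Phi> (y n)) - g) \<longlonglongrightarrow> 0"
    using res by (simp add: tendsto_cong)
  then show ?thesis using yB \<open>y \<longlonglongrightarrow> ys\<close> by blast
qed

lemma inverse_derivative:
  obtains S :: "'v \<Rightarrow>\<^sub>L 'v" where "\<And>x. S ((id_blinfun - D\<Phi> ys) x) = x" "\<And>w. (id_blinfun - D\<Phi> ys) (S w) = w"
proof -
  let ?T = "id_blinfun - D\<Phi> ys"
  have ys: "ys \<in> cball ys \<delta>" using const_pos by simp
  define S where "S = inv (blinfun_apply ?T)"
  have TS: "?T (S w) = w" and ST: "S (?T x) = x" for w x
    using bij_T[OF ys] unfolding S_def by (auto simp: bij_is_surj surj_f_inv_f bij_is_inj simp del: blinfun_apply_id_blinfun)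
  have "bounded_linear S"
  proof (rule bounded_linear_intro)
    show "S (v + w) = S v + S w" for v w
      using ST[of "S v + S w"] TS[of v] TS[of w] by (simp only: blinfun.add_right)
    show "S (r *\<^sub>R v) = r *\<^sub>R S v" for r v
      using ST[of "r *\<^sub>R S v"] TS[of v] by (simp only: blinfun.scaleR_right)
    show "norm (S w) \<le> norm w * (b / C)" for w
      using norm_inv_bound[OF ys, of "S w"] by (simp only: TS mult.commute)
  qed
  then have "blinfun_apply (Blinfun S) = S" by (rule bounded_linear_Blinfun_apply)
  then show thesis using ST TS by (intro that[of "Blinfun S"]) simp_all
qed

text \<open>The preimage of \<open>p n\<close> under the derivative at \<open>y n\<close> is
  replaced by \<open>S (p n)\<close>, with \<open>S\<close> the inverse at \<open>ys\<close>, up to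
  a strongly vanishing error. The quadratic form \<open>A (S p) p\<close> is nonnegative, hence
  weakly lower semicontinuous, and this is the direction the limit needs.\<close>

lemma multiplier_sign:
  assumes y: "\<And>n. y n \<in> cball ys \<delta>" "y \<longlonglongrightarrow> ys"
    and p: "weak_tendsto p pb sequentially" "bounded (range p)" and e: "e \<longlonglongrightarrow> 0" "\<And>n. 0 \<le> e n"
    and le: "\<And>n x. p n = (id_blinfun - D\<Phi> (y n)) x \<Longrightarrow>
      inner (\<iota> (y n) - y\<^sub>d) (\<iota> x) + A x (p n) \<le> e n * norm x"
    and xb: "pb = (id_blinfun - D\<Phi> ys) xb"
  shows "inner (\<iota> ys - y\<^sub>d) (\<iota> xb) + A xb pb \<le> 0"
proof -
  define T where "T = (\<lambda>y. id_blinfun - D\<Phi> y)"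
  have ys: "ys \<in> cball ys \<delta>" using const_pos by simp
  obtain S :: "'v \<Rightarrow>\<^sub>L 'v" where ST: "\<And>x. S (T ys x) = x" and TS: "\<And>w. T ys (S w) = w"
    using inverse_derivative unfolding T_def by blast
  obtain M where M: "\<And>n. norm (p n) \<le> M" using p(2) by (auto simp: bounded_iff)
  have "\<exists>x. p n = T (y n) x" for n using bij_T[OF y(1)] unfolding T_def by (metis bij_pointE)
  then obtain x where x: "\<And>n. p n = T (y n) (x n)" by metis
  define K where "K = b / C * M"
  have xK: "norm (x n) \<le> K" for n
  proof -
    have "norm (x n) \<le> b / C * norm (p n)" using norm_inv_bound[OF y(1), of "x n" n] x[of n] by (simp add: T_def)
    also have "\<dots> \<le> K" unfolding K_def using M const_pos C_pos by (intro mult_left_mono) auto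
    finally show ?thesis .
  qed
  have D: "(\<lambda>n. D\<Phi> (y n)) \<longlonglongrightarrow> D\<Phi> ys"
    using continuous_on_tendsto_compose[OF D\<Phi>_continuous y(2) ys] y(1) by simp
  have diff: "(\<lambda>n. x n - S (p n)) \<longlonglongrightarrow> 0"
  proof (rule Lim_null_comparison)
    have "norm (x n - S (p n)) \<le> b / C * (norm (D\<Phi> (y n) - D\<Phi> ys) * K)" for n
    proof -
      \<comment> \<open>Both \<open>T ys (S (p n))\<close> and \<open>T (y n) (x n)\<close> equal
        \<open>p n\<close>, so only the difference of the derivatives remains.\<close>
      have "T ys (x n - S (p n)) = (D\<Phi> (y n) - D\<Phi> ys) (x n)"
        using TS[of "p n"] x[of n] by (simp add: T_def blinfun.bilinear_simps)
      then have "norm (x n - S (p n)) \<le> b / C * norm ((D\<Phi> (y n) - D\<Phi> ys) (x n))"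
        using norm_inv_bound[OF ys, of "x n - S (p n)"] by (simp add: T_def)
      also have "\<dots> \<le> b / C * (norm (D\<Phi> (y n) - D\<Phi> ys) * K)"
        using const_pos C_pos norm_blinfun[of "D\<Phi> (y n) - D\<Phi> ys" "x n"]
          mult_left_mono[OF xK[of n], of "norm (D\<Phi> (y n) - D\<Phi> ys)"]
        by (intro mult_left_mono) auto
      finally show ?thesis .
    qed
    then show "\<forall>\<^sub>F n in sequentially. norm (x n - S (p n)) \<le> b / C * (norm (D\<Phi> (y n) - D\<Phi> ys) * K)"
      by simp
    have "(\<lambda>n. b / C * (norm (D\<Phi> (y n) - D\<Phi> ys) * K)) \<longlonglongrightarrow> b / C * (norm (D\<Phi> ys - D\<Phi> ys) * K)"
      by (intro tendsto_mult tendsto_const tendsto_norm tendsto_diff D)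
    then show "(\<lambda>n. b / C * (norm (D\<Phi> (y n) - D\<Phi> ys) * K)) \<longlonglongrightarrow> 0" by simp
  qed
  have Sp: "(\<lambda>n. f (S (p n))) \<longlonglongrightarrow> f (S pb)" for f :: "'v \<Rightarrow>\<^sub>L real"
  proof -
    have "(\<lambda>n. (f o\<^sub>L S) (p n)) \<longlonglongrightarrow> (f o\<^sub>L S) pb"
      using p(1) unfolding weak_tendsto_def by blast
    then show ?thesis by simp
  qed
  have x_weak: "weak_tendsto x (S pb) sequentially"
    unfolding weak_tendsto_def
  proof
    fix f :: "'v \<Rightarrow>\<^sub>L real"
    have "(\<lambda>n. f (S (p n)) + f (x n - S (p n))) \<longlonglongrightarrow> f (S pb) + f 0"
      by (rule tendsto_add[OF Sp blinfun.tendsto[OF tendsto_const diff]])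
    then show "(\<lambda>n. f (x n)) \<longlonglongrightarrow> f (S pb)" by (simp add: blinfun.bilinear_simps)
  qed
  have x_bounded: "bounded (range x)" using xK by (auto simp: bounded_iff)
  have lim1: "(\<lambda>n. inner (\<iota> (y n) - y\<^sub>d) (\<iota> (x n))) \<longlonglongrightarrow> inner (\<iota> ys - y\<^sub>d) (\<iota> (S pb))"
  proof -
    have "(\<lambda>n. blinfun_inner_right (\<iota> (y n) - y\<^sub>d) o\<^sub>L \<iota>) \<longlonglongrightarrow> (blinfun_inner_right (\<iota> ys - y\<^sub>d) o\<^sub>L \<iota>)"
      by (intro bounded_bilinear.tendsto[OF bounded_bilinear_blinfun_compose] tendsto_const
          bounded_linear.tendsto[OF bounded_linear_blinfun_inner_right] tendsto_diff blinfun.tendsto y)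
    from weak_tendsto_pairing[OF this x_weak x_bounded] show ?thesis
      by (simp add: blinfun_inner_right.rep_eq)
  qed
  have lim2: "(\<lambda>n. A (x n - S (p n)) (p n)) \<longlonglongrightarrow> A 0 pb"
    by (rule weak_tendsto_pairing[OF blinfun.tendsto[OF tendsto_const diff] p])
  have lim3: "(\<lambda>n. A (S (p n)) pb) \<longlonglongrightarrow> A (S pb) pb"
    using Sp[of "form_adjoint A pb"] by (simp add: form_adjoint.rep_eq)
  have lim4: "(\<lambda>n. A (S pb) (p n)) \<longlonglongrightarrow> A (S pb) pb"
    using p(1) by (simp add: weak_tendsto_def)
  \<comment> \<open>A lower bound for the left side of \<open>le\<close> in which the quadratic term
    is replaced by its tangent at \<open>pb\<close>. Each summand is now linear in a weakly
    convergent sequence or pairs it with a strongly convergent one.\<close>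
  define low where "low = (\<lambda>n. inner (\<iota> (y n) - y\<^sub>d) (\<iota> (x n)) + A (x n - S (p n)) (p n)
    + A (S (p n)) pb + A (S pb) (p n) - A (S pb) pb)"
  have "low n \<le> e n * K" for n
  proof -
    have "0 \<le> A (S (p n - pb)) (p n - pb)"
    proof -
      have "0 \<le> a * (norm (T ys (S (p n - pb))))\<^sup>2" using const_pos by simp
      also have "\<dots> \<le> A (S (p n - pb)) (T ys (S (p n - pb)))"
        unfolding T_def by (rule uniform_coercive[OF ys])
      finally show ?thesis by (simp add: TS)
    qed
    then have "A (S (p n)) pb + A (S pb) (p n) - A (S pb) pb \<le> A (S (p n)) (p n)"
      by (simp add: blinfun.bilinear_simps)
    then have "low n \<le> inner (\<iota> (y n) - y\<^sub>d) (\<iota> (x n)) + A (x n) (p n)"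
      by (simp add: low_def blinfun.bilinear_simps)
    also have "\<dots> \<le> e n * norm (x n)" using x[of n] by (intro le) (simp add: T_def)
    also have "\<dots> \<le> e n * K" using xK e(2) by (intro mult_left_mono) auto
    finally show ?thesis .
  qed
  moreover have "(\<lambda>n. e n * K) \<longlonglongrightarrow> 0" using e(1) by (rule tendsto_mult_left_zero)
  moreover have "low \<longlonglongrightarrow> inner (\<iota> ys - y\<^sub>d) (\<iota> (S pb)) + A 0 pb + A (S pb) pb + A (S pb) pb - A (S pb) pb"
    unfolding low_def by (intro tendsto_add tendsto_diff lim1 lim2 lim3 lim4 tendsto_const)
  ultimately have "inner (\<iota> ys - y\<^sub>d) (\<iota> (S pb)) + A 0 pb + A (S pb) pb + A (S pb) pb - A (S pb) pb \<le> 0"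
    by (intro LIMSEQ_le) auto
  moreover have "S pb = xb" using xb ST[of xb] by (simp add: T_def)
  ultimately show ?thesis by simp
qed

end

section \<open>Passage to the limit in the stationarity system\<close>

lemma Cauchy_of_dist_bound:
  fixes u :: "nat \<Rightarrow> 'a::metric_space" and q :: "nat \<Rightarrow> 'b::metric_space"
  assumes "Cauchy q" "e \<longlonglongrightarrow> 0" "\<And>n m. dist (u n) (u m) \<le> dist (q n) (q m) + e n + e m"
  shows "Cauchy u"
proof (rule metric_CauchyI)
  fix r :: real assume "r > 0"
  then obtain M where M: "\<And>m n. m \<ge> M \<Longrightarrow> n \<ge> M \<Longrightarrow> dist (q m) (q n) < r / 3"
    using metric_CauchyD[OF assms(1), of "r / 3"] by auto
  have "\<forall>\<^sub>F n in sequentially. e n < r / 3" using assms(2) \<open>r > 0\<close> by (intro order_tendstoD) auto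
  then obtain N where N: "\<And>n. n \<ge> N \<Longrightarrow> e n < r / 3" by (auto simp: eventually_sequentially)
  have "dist (u m) (u n) < r" if "m \<ge> max M N" "n \<ge> max M N" for m n
    using M[of m n] N[of m] N[of n] assms(3)[of m n] that by simp
  then show "\<exists>M. \<forall>m\<ge>M. \<forall>n\<ge>M. dist (u m) (u n) < r" by blast
qed

lemma into_dual_apply: "blinfun_apply (into_dual \<iota> h) v = inner h (\<iota> v)"
  by (simp add: into_dual_def blinfun_inner_right.rep_eq)

lemma bounded_linear_into_dual: "bounded_linear (into_dual \<iota>)"
  unfolding into_dual_def
  by (rule bounded_linear_compose[OF bounded_bilinear.bounded_linear_left[OF bounded_bilinear_blinfun_compose]
        bounded_linear_blinfun_inner_right])

text \<open>Undoes the restriction to a ball of controls: moving from \<open>us\<close> a small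
  fraction \<open>t\<close> towards \<open>v\<close> stays in the ball, and the inequality scales by
  \<open>t\<close>.\<close>

lemma convex_local_variational_inequality:
  fixes U :: "'h::real_inner set"
  assumes "convex U" "us \<in> U" "\<gamma> > 0" "v \<in> U"
    and loc: "\<And>v. v \<in> U \<Longrightarrow> norm (v - us) \<le> \<gamma> \<Longrightarrow> 0 \<le> inner w (v - us)"
  shows "0 \<le> inner w (v - us)"
proof -
  define t where "t = min 1 (\<gamma> / (norm (v - us) + 1))"
  have pos: "norm (v - us) + 1 > 0" by (intro add_nonneg_pos) auto
  have t: "0 < t" "t \<le> 1" using assms(3) pos by (auto simp: t_def)
  have "t * norm (v - us) \<le> t * (norm (v - us) + 1)" using t by simp
  also have "\<dots> \<le> \<gamma> / (norm (v - us) + 1) * (norm (v - us) + 1)"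
    using pos by (intro mult_right_mono) (auto simp: t_def)
  also have "\<dots> = \<gamma>" using pos by simp
  finally have small: "norm (us + t *\<^sub>R (v - us) - us) \<le> \<gamma>" using t by simp
  have "(1 - t) *\<^sub>R us + t *\<^sub>R v \<in> U" using assms(1,2,4) t by (auto simp: convex_alt)
  then have "us + t *\<^sub>R (v - us) \<in> U" by (simp add: algebra_simps)
  from loc[OF this small] show ?thesis using t by (simp add: zero_le_mult_iff)
qed

context penalised_qvi
begin

text \<open>The control problem is penalised around the feasible pairs (\<open>z n\<close>,
  \<open>us\<close>), which nearly solve the penalised state equation. The limit pair satisfies the
  QVI with a value no larger than the optimum, so local minimality and the extra term in
  \<open>fu\<close> identify it.\<close>

lemma stationary_multiplier:
  assumes us: "us \<in> U" and U: "closed U" "convex U" and \<nu>: "\<nu> > 0"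
    and Q: "qvi_solutions A \<Phi> (into_dual \<iota> us) = {ys}" and "\<gamma> > 0"
    and min: "\<And>u y. u \<in> U \<Longrightarrow> norm (u - us) \<le> \<gamma> \<Longrightarrow> y \<in> qvi_solutions A \<Phi> (into_dual \<iota> u) \<Longrightarrow>
      cost \<iota> \<nu> y\<^sub>d ys us \<le> cost \<iota> \<nu> y\<^sub>d y u"
  shows "\<exists>p. (\<forall>v\<in>U. inner (\<nu> *\<^sub>R us - \<iota> p) (us - v) \<le> 0) \<and>
    (\<forall>x. p = (id_blinfun - D\<Phi> ys) x \<longrightarrow> inner (\<iota> ys - y\<^sub>d) (\<iota> x) + A x p \<le> 0)"
proof -
  obtain J :: "('v \<Rightarrow>\<^sub>L real) \<Rightarrow>\<^sub>L 'v" and k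
    where sym: "\<And>g h. blinfun_apply g (J h) = blinfun_apply h (J g)"
      and k: "k > 0" "\<And>g. k * (norm g)\<^sup>2 \<le> blinfun_apply g (J g)"
    using riesz_operator[OF C_pos coercive] by blast
  have pos: "0 \<le> blinfun_apply g (J g)" for g :: "'v \<Rightarrow>\<^sub>L real"
    using k(2)[of g] k(1) order_trans[of 0 "k * (norm g)\<^sup>2"] by simp
  define L where "L = Blinfun (into_dual \<iota>)"
  have L: "blinfun_apply L = into_dual \<iota>"
    unfolding L_def by (rule bounded_linear_Blinfun_apply[OF bounded_linear_into_dual])
  have ysB: "ys \<in> cball ys \<delta>" using const_pos by simp
  define S where "S = (\<lambda>n y. A y + P n (y - \<Phi> y))"
  define dS where "dS = (\<lambda>n y x. A x + frechet_derivative (P n) (at (y - \<Phi> y)) ((id_blinfun - D\<Phi> y) x))"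
  obtain z where z: "\<And>n. z n \<in> cball ys \<delta>" "z \<longlonglongrightarrow> ys" "(\<lambda>n. S n (z n) - L us) \<longlonglongrightarrow> 0"
    using reference_states[of "into_dual \<iota> us"] Q unfolding S_def L by auto
  define rz where "rz = (\<lambda>n. S n (z n) - L us)"
  \<comment> \<open>States depend on the right-hand side with Lipschitz constant
    \<open>l / c\<close>. Controls within \<open>\<gamma>0\<close> of \<open>us\<close> thus move
    them by at most \<open>\<delta> / 4\<close>, apart from the residuals. The \<open>+ 1\<close>
    avoids division by 0.\<close>
  define \<kappa> where "\<kappa> = l / c * (norm L + 1)"
  have \<kappa>: "\<kappa> > 0" unfolding \<kappa>_def using const_pos by (intro mult_pos_pos add_nonneg_pos) auto
  define \<gamma>0 where "\<gamma>0 = min \<gamma> (\<delta> / 4 / \<kappa>)"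
  have \<gamma>0: "\<gamma>0 > 0" "\<gamma>0 \<le> \<gamma>" "l / c * (norm L * \<gamma>0) \<le> \<delta> / 4"
  proof -
    show "\<gamma>0 > 0" using \<open>\<gamma> > 0\<close> \<kappa> const_pos by (simp add: \<gamma>0_def)
    have "norm L * \<gamma>0 \<le> (norm L + 1) * \<gamma>0" using \<open>\<gamma>0 > 0\<close> by (intro mult_right_mono) auto
    then have "l / c * (norm L * \<gamma>0) \<le> \<kappa> * \<gamma>0"
      using const_pos mult_left_mono[of "norm L * \<gamma>0" "(norm L + 1) * \<gamma>0" "l / c"]
      by (simp add: \<kappa>_def mult.assoc)
    also have "\<dots> \<le> \<kappa> * (\<delta> / 4 / \<kappa>)"
      using \<kappa> by (intro mult_left_mono) (auto simp: \<gamma>0_def)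
    also have "\<dots> = \<delta> / 4" using \<kappa> by simp
    finally show "l / c * (norm L * \<gamma>0) \<le> \<delta> / 4" .
  qed (simp add: \<gamma>0_def)
  define U0 where "U0 = U \<inter> cball us \<gamma>0"
  have U0: "closed U0" "convex U0" "us \<in> U0"
    using U us \<gamma>0(1) by (auto simp: U0_def intro: convex_Int)
  define e :: "nat \<Rightarrow> real" where "e = (\<lambda>n. 1 / real (Suc n))"
  have e: "\<And>n. e n > 0" "e \<longlonglongrightarrow> 0"
    unfolding e_def by (simp, rule LIMSEQ_Suc[OF lim_const_over_n])
  \<comment> \<open>As \<open>\<tau> n\<close> dominates \<open>norm (rz n)\<close>, the penalty at
    the comparison point is at most \<open>norm J * norm (rz n) / 2\<close>, which tends to 0;
    \<open>e n\<close> keeps \<open>\<tau> n\<close> positive.\<close>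
  define \<tau> where "\<tau> = (\<lambda>n. norm (rz n) + e n)"
  have \<tau>: "\<And>n. \<tau> n > 0" "\<tau> \<longlonglongrightarrow> 0"
  proof -
    show "\<tau> n > 0" for n unfolding \<tau>_def using e(1)[of n] by (intro add_nonneg_pos) auto
    have "(\<lambda>n. norm (rz n) + e n) \<longlonglongrightarrow> norm (0 :: 'v \<Rightarrow>\<^sub>L real) + 0"
      unfolding rz_def by (intro tendsto_add tendsto_norm z(3) e)
    then show "\<tau> \<longlonglongrightarrow> 0" by (simp add: \<tau>_def)
  qed
  define fy where "fy = (\<lambda>y. 1/2 * inner (\<iota> y - y\<^sub>d) (\<iota> y - y\<^sub>d))"
  define fu where "fu = (\<lambda>u. \<nu>/2 * inner u u + 1/2 * inner (u - us) (u - us))"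
  have cost: "cost \<iota> \<nu> y\<^sub>d y u = fy y + fu u - 1/2 * (norm (u - us))\<^sup>2" for y u
    by (simp add: cost_def fy_def fu_def power2_norm_eq_inner)
  have fy_pos: "0 \<le> fy y" and fu_pos: "0 \<le> fu u" for y u
    using \<nu> by (simp_all add: fy_def fu_def)
  have fy_der: "(fy has_derivative (\<lambda>x. inner (\<iota> y - y\<^sub>d) (\<iota> x))) (at y)" for y
  proof -
    have "((\<lambda>y. \<iota> y - y\<^sub>d) has_derivative (\<lambda>x. \<iota> x)) (at y)"
      using has_derivative_diff[OF bounded_linear_imp_has_derivative[OF blinfun.bounded_linear_right] has_derivative_const]
      by simp
    from has_derivative_mult_right[OF has_derivative_inner[OF this this], of "1/2"]
    show ?thesis unfolding fy_def by (rule has_derivative_eq_rhs) (simp add: inner_commute fun_eq_iff)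
  qed
  have fu_der: "(fu has_derivative (\<lambda>h. inner (\<nu> *\<^sub>R u + (u - us)) h)) (at u)" for u
  proof -
    have "((\<lambda>u. u - us) has_derivative (\<lambda>h. h)) (at u)"
      using has_derivative_diff[OF has_derivative_ident has_derivative_const] by simp
    from has_derivative_add[OF has_derivative_mult_right[OF has_derivative_inner[OF has_derivative_ident has_derivative_ident], of "\<nu>/2"]
        has_derivative_mult_right[OF has_derivative_inner[OF this this], of "1/2"]]
    show ?thesis unfolding fu_def
      by (rule has_derivative_eq_rhs) (simp add: inner_commute fun_eq_iff inner_left_distrib inner_right_distrib)
  qed
  define V where "V = (\<lambda>n. fy (z n) + fu us + norm J * norm (rz n) / 2)"
  define N where "N = (\<lambda>g. blinfun_apply g (J g))"
  define R where "R = (\<lambda>n y u p. y \<in> cball ys \<delta> \<and> u \<in> U0 \<and>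
    fy y + fu u + N (S n y - L u) / (2 * \<tau> n) \<le> V n \<and>
    (y \<in> interior (cball ys \<delta>) \<longrightarrow>
      (\<forall>x. - e n * norm x \<le> inner (\<iota> y - y\<^sub>d) (\<iota> x) + blinfun_apply (dS n y x) p)) \<and>
    (\<forall>v\<in>U0. - e n * norm (v - u) \<le> inner (\<nu> *\<^sub>R u + (u - us)) (v - u) - L (v - u) p))"
  have "\<exists>y u p. R n y u p" for n
  proof -
    have "\<exists>y\<in>cball ys \<delta>. \<exists>u\<in>U0. \<exists>p. p = (1 / \<tau> n) *\<^sub>R J (S n y - L u) \<and>
      fy y + fu u + blinfun_apply (S n y - L u) (J (S n y - L u)) / (2 * \<tau> n)
        \<le> fy (z n) + fu us + blinfun_apply (S n (z n) - L us) (J (S n (z n) - L us)) / (2 * \<tau> n) \<and>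
      (y \<in> interior (cball ys \<delta>) \<longrightarrow>
        (\<forall>x. - e n * norm x \<le> inner (\<iota> y - y\<^sub>d) (\<iota> x) + blinfun_apply (dS n y x) p)) \<and>
      (\<forall>v\<in>U0. - e n * norm (v - u) \<le> inner (\<nu> *\<^sub>R u + (u - us)) (v - u) - L (v - u) p)"
    proof (rule penalised_stationary_point[where cy = fy and cu = fu and dcy = "\<lambda>y x. inner (\<iota> y - y\<^sub>d) (\<iota> x)"
          and dcu = "\<lambda>u h. inner (\<nu> *\<^sub>R u + (u - us)) h" and yi = "z n" and ui = us, OF sym pos])
      show "(S n has_derivative dS n y) (at y)" if "y \<in> cball ys \<delta>" for y
        using has_derivative_penalised_state[OF that] unfolding S_def dS_def .
    qed (use e \<tau> z U0 fy_pos fu_pos fy_der fu_der in auto)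
    then obtain y u p where *: "y \<in> cball ys \<delta>" "u \<in> U0"
      "fy y + fu u + blinfun_apply (S n y - L u) (J (S n y - L u)) / (2 * \<tau> n)
        \<le> fy (z n) + fu us + blinfun_apply (S n (z n) - L us) (J (S n (z n) - L us)) / (2 * \<tau> n)"
      "y \<in> interior (cball ys \<delta>) \<longrightarrow>
        (\<forall>x. - e n * norm x \<le> inner (\<iota> y - y\<^sub>d) (\<iota> x) + blinfun_apply (dS n y x) p)"
      "\<forall>v\<in>U0. - e n * norm (v - u) \<le> inner (\<nu> *\<^sub>R u + (u - us)) (v - u) - L (v - u) p" by blast
    have "N (rz n) / (2 * \<tau> n) \<le> norm J * norm (rz n) / 2"
    proof -
      have "N (rz n) \<le> norm (rz n) * norm (J (rz n))" unfolding N_def using norm_blinfun[of "rz n" "J (rz n)"] by simp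
      also have "\<dots> \<le> norm (rz n) * (norm J * norm (rz n))" by (intro mult_left_mono norm_blinfun) simp
      also have "\<dots> = norm J * norm (rz n) * norm (rz n)" by simp
      also have "\<dots> \<le> norm J * norm (rz n) * \<tau> n"
        using e(1)[of n] by (intro mult_left_mono) (auto simp: \<tau>_def)
      finally show ?thesis using \<tau>(1)[of n] by (simp add: field_simps)
    qed
    then have "fy y + fu u + N (S n y - L u) / (2 * \<tau> n) \<le> V n" using *(3) by (simp add: V_def N_def rz_def)
    then have "R n y u p" unfolding R_def using *(1,2,4,5) by blast
    then show ?thesis by blast
  qed
  then obtain y u p where R: "\<And>n. R n (y n) (u n) (p n)" by metis
  have yB: "\<And>n. y n \<in> cball ys \<delta>" and uU: "\<And>n. u n \<in> U0"
    and val: "\<And>n. fy (y n) + fu (u n) + N (S n (y n) - L (u n)) / (2 * \<tau> n) \<le> V n"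
    and stat_y: "\<And>n x. y n \<in> interior (cball ys \<delta>) \<Longrightarrow>
      - e n * norm x \<le> inner (\<iota> (y n) - y\<^sub>d) (\<iota> x) + blinfun_apply (dS n (y n) x) (p n)"
    and stat_u: "\<And>n v. v \<in> U0 \<Longrightarrow>
      - e n * norm (v - u n) \<le> inner (\<nu> *\<^sub>R u n + (u n - us)) (v - u n) - L (v - u n) (p n)"
    using R unfolding R_def by blast+
  define ry where "ry = (\<lambda>n. S n (y n) - L (u n))"
  have N_pos: "0 \<le> N g" for g using pos by (simp add: N_def)
  have V: "V \<longlonglongrightarrow> fy ys + fu us"
  proof -
    have "isCont fy ys" using fy_der by (rule has_derivative_continuous)
    then have "(\<lambda>n. fy (z n)) \<longlonglongrightarrow> fy ys" using z(2) by (rule isCont_tendsto_compose)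
    then have "(\<lambda>n. fy (z n) + fu us + norm J * norm (rz n) / 2) \<longlonglongrightarrow> fy ys + fu us + norm J * norm (0 :: 'v \<Rightarrow>\<^sub>L real) / 2"
      unfolding rz_def by (intro tendsto_add tendsto_const tendsto_divide tendsto_mult tendsto_norm z(3)) simp_all
    then show ?thesis by (simp add: V_def)
  qed
  have ry: "ry \<longlonglongrightarrow> 0"
  proof (rule tendsto_of_square_bound)
    show "(norm (ry n - 0))\<^sup>2 \<le> 2 * \<tau> n * V n / k" for n
    proof -
      have "N (ry n) / (2 * \<tau> n) \<le> V n" using val[of n] fy_pos[of "y n"] fu_pos[of "u n"] by (simp add: ry_def)
      then have "N (ry n) \<le> 2 * \<tau> n * V n" using \<tau>(1)[of n] by (simp add: pos_divide_le_eq mult.commute)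
      then have "k * (norm (ry n))\<^sup>2 \<le> 2 * \<tau> n * V n" using k(2)[of "ry n"] by (simp add: N_def)
      then show ?thesis using k(1) by (simp add: pos_le_divide_eq mult.commute)
    qed
    have "(\<lambda>n. 2 * \<tau> n * V n / k) \<longlonglongrightarrow> 2 * 0 * (fy ys + fu us) / k"
      using k(1) by (intro tendsto_divide tendsto_mult tendsto_const \<tau> V) auto
    then show "(\<lambda>n. 2 * \<tau> n * V n / k) \<longlonglongrightarrow> 0" by simp
  qed
  \<comment> \<open>The penalised equations for \<open>y n\<close> and \<open>z n\<close> are
    subtracted and tested with the difference of \<open>y n - \<Phi> (y n)\<close> and
    \<open>z n - \<Phi> (z n)\<close>; the monotone penalty drops out.\<close>
  have close: "norm (y n - z n) \<le> l / c * (norm L * \<gamma>0) + l / c * (norm (ry n) + norm (rz n))" for n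
  proof -
    let ?d = "y n - z n" and ?w = "(y n - \<Phi> (y n)) - (z n - \<Phi> (z n))"
    let ?g = "L (u n - us) + ry n - rz n"
    have "A ?d = ?g - (P n (y n - \<Phi> (y n)) - P n (z n - \<Phi> (z n)))"
      by (simp add: ry_def rz_def S_def blinfun.diff_right)
    then have "A ?d ?w \<le> ?g ?w"
      using P_mono[of n "y n - \<Phi> (y n)" "z n - \<Phi> (z n)"] by (simp add: blinfun.diff_left)
    also have "?g ?w \<le> norm ?g * norm ?w" using norm_blinfun[of ?g ?w] by simp
    also have "\<dots> \<le> norm ?g * (l * norm ?d)" by (intro mult_left_mono lipschitz yB z) simp
    finally have "c * (norm ?d)\<^sup>2 \<le> norm ?g * (l * norm ?d)"
      using strongly_monotone[OF yB[of n] z(1)[of n]] by linarith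
    then have "(c * norm ?d) * norm ?d \<le> (norm ?g * l) * norm ?d" by (simp add: power2_eq_square ac_simps)
    then have "c * norm ?d \<le> norm ?g * l"
      using const_pos mult_right_le_imp_le[of "c * norm ?d" "norm ?d" "norm ?g * l"] by (cases "?d = 0") simp_all
    then have d: "norm ?d \<le> l / c * norm ?g" using const_pos by (simp add: field_simps)
    have "norm ?g \<le> norm L * \<gamma>0 + (norm (ry n) + norm (rz n))"
    proof -
      have "norm (L (u n - us)) \<le> norm L * norm (u n - us)" by (rule norm_blinfun)
      also have "\<dots> \<le> norm L * \<gamma>0"
        using uU[of n] by (intro mult_left_mono) (auto simp: U0_def dist_norm norm_minus_commute)
      finally show ?thesis
        using norm_triangle_ineq4[of "L (u n - us) + ry n" "rz n"] norm_triangle_ineq[of "L (u n - us)" "ry n"] by linarith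
    qed
    then have "l / c * norm ?g \<le> l / c * (norm L * \<gamma>0 + (norm (ry n) + norm (rz n)))"
      using const_pos by (intro mult_left_mono) auto
    then show ?thesis using d by (simp only: distrib_left)
  qed
  have "\<forall>\<^sub>F n in sequentially. \<delta> / 4 + l / c * (norm (ry n) + norm (rz n)) + dist (z n) ys < \<delta>"
  proof -
    have "(\<lambda>n. \<delta> / 4 + l / c * (norm (ry n) + norm (rz n)) + dist (z n) ys) \<longlonglongrightarrow>
        \<delta> / 4 + l / c * (norm (0 :: 'v \<Rightarrow>\<^sub>L real) + norm (0 :: 'v \<Rightarrow>\<^sub>L real)) + dist ys ys"
      using z(3) unfolding rz_def[symmetric]
      by (intro tendsto_add tendsto_mult tendsto_const tendsto_norm tendsto_dist ry z(2))
    then have "(\<lambda>n. \<delta> / 4 + l / c * (norm (ry n) + norm (rz n)) + dist (z n) ys) \<longlonglongrightarrow> \<delta> / 4" by simp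
    from order_tendstoD(2)[OF this, of \<delta>] show ?thesis using const_pos by simp
  qed
  then obtain n0 where n0: "\<And>n. n \<ge> n0 \<Longrightarrow> \<delta> / 4 + l / c * (norm (ry n) + norm (rz n)) + dist (z n) ys < \<delta>"
    by (auto simp: eventually_sequentially)
  have int: "y n \<in> interior (cball ys \<delta>)" if "n \<ge> n0" for n
  proof -
    have "dist (y n) ys \<le> norm (y n - z n) + dist (z n) ys" unfolding dist_norm[of "y n"]
      using dist_triangle[of "y n" ys "z n"] by (simp add: dist_norm)
    then have "dist (y n) ys < \<delta>" using n0[OF that] close[of n] \<gamma>0(3) by linarith
    then show ?thesis by (rule in_interior_cball)
  qed
  \<comment> \<open>The summand 1 covers \<open>e n\<close>, the rest bounds the derivative of the
    tracking term on the ball.\<close>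
  define K where "K = 1 + (norm \<iota> * (norm ys + \<delta>) + norm y\<^sub>d) * norm \<iota>"
  have p_bound: "norm (p n) \<le> K * b / (C * a)" if "n \<ge> n0" for n
  proof (rule adjoint_bound_frechet[OF yB])
    show "0 \<le> K" using const_pos by (simp add: K_def)
    show "- K * norm x \<le> blinfun_apply (A x + frechet_derivative (P n) (at (y n - \<Phi> (y n)))
        ((id_blinfun - D\<Phi> (y n)) x)) (p n)" for x
    proof -
      have "inner (\<iota> (y n) - y\<^sub>d) (\<iota> x) \<le> norm (\<iota> (y n) - y\<^sub>d) * norm (\<iota> x)" by (rule norm_cauchy_schwarz)
      also have "\<dots> \<le> (norm \<iota> * (norm ys + \<delta>) + norm y\<^sub>d) * (norm \<iota> * norm x)"
      proof (intro mult_mono norm_blinfun)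
        have "norm (y n) \<le> norm ys + \<delta>"
          using yB[of n] norm_triangle_ineq2[of "y n" ys] by (simp add: dist_norm norm_minus_commute)
        then have "norm (\<iota> (y n)) \<le> norm \<iota> * (norm ys + \<delta>)"
          using norm_blinfun[of \<iota> "y n"] mult_left_mono[of "norm (y n)" "norm ys + \<delta>" "norm \<iota>"] by simp
        then show "norm (\<iota> (y n) - y\<^sub>d) \<le> norm \<iota> * (norm ys + \<delta>) + norm y\<^sub>d"
          using norm_triangle_ineq4[of "\<iota> (y n)" y\<^sub>d] by simp
      qed (use const_pos in auto)
      finally have "inner (\<iota> (y n) - y\<^sub>d) (\<iota> x) \<le> (K - 1) * norm x" by (simp add: K_def mult.assoc)
      moreover have "e n * norm x \<le> 1 * norm x" by (intro mult_right_mono) (auto simp: e_def)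
      ultimately show ?thesis using stat_y[OF int[OF that], of x] by (simp add: dS_def left_diff_distrib)
    qed
  qed
  \<comment> \<open>The bound on \<open>p n\<close> is known only once the states are interior, so
    the first \<open>n0\<close> indices are skipped.\<close>
  define q where "q = (\<lambda>n. p (n + n0))"
  have q_bdd: "bounded (range q)" using p_bound by (intro boundedI[of _ "K * b / (C * a)"]) (auto simp: q_def)
  obtain r1 pb where r1: "strict_mono r1" and weak1: "weak_tendsto (\<lambda>n. q (r1 n)) pb sequentially"
      and \<iota>q: "(\<lambda>n. \<iota> (q (r1 n))) \<longlonglongrightarrow> \<iota> pb"
    using weakly_convergent_subsequence[OF q_bdd] by metis
  define r where "r = (\<lambda>n. r1 n + n0)"
  have r: "strict_mono r" using r1 by (auto simp: r_def strict_mono_def)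
  have r_ge: "r n \<ge> n0" for n by (simp add: r_def)
  have weak: "weak_tendsto (\<lambda>n. p (r n)) pb sequentially" and \<iota>p: "(\<lambda>n. \<iota> (p (r n))) \<longlonglongrightarrow> \<iota> pb"
    using weak1 \<iota>q by (simp_all add: q_def r_def)
  have er: "(\<lambda>n. e (r n)) \<longlonglongrightarrow> 0" using LIMSEQ_subseq_LIMSEQ[OF e(2) r] by (simp add: o_def)
  have stat_u': "0 \<le> inner (\<nu> *\<^sub>R u n + (u n - us) - \<iota> (p n)) (v - u n) + e n * norm (v - u n)" if "v \<in> U0" for n v
    using stat_u[OF that, of n] inner_diff_left[of "\<nu> *\<^sub>R u n + (u n - us)" "\<iota> (p n)" "v - u n"]
      inner_commute[of "\<iota> (p n)" "v - u n"] unfolding L into_dual_apply by linarith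
  \<comment> \<open>Two variational inequalities, each tested with the other control, are added. The
    gradient of the control cost is strongly monotone with constant \<open>\<nu> + 1\<close>, so the
    controls inherit the Cauchy property from \<open>\<iota> p\<close>.\<close>
  have "Cauchy (\<lambda>n. u (r n))"
  proof (rule Cauchy_of_dist_bound[OF LIMSEQ_imp_Cauchy[OF \<iota>p] er])
    fix i j
    let ?u = "u (r i)" and ?v = "u (r j)" and ?p = "\<iota> (p (r i))" and ?q = "\<iota> (p (r j))"
    have "0 \<le> inner (\<nu> *\<^sub>R ?u + (?u - us) - ?p) (?v - ?u) + e (r i) * norm (?v - ?u)"
      "0 \<le> inner (\<nu> *\<^sub>R ?v + (?v - us) - ?q) (?u - ?v) + e (r j) * norm (?u - ?v)"
      by (intro stat_u' uU)+
    moreover have "inner (\<nu> *\<^sub>R ?u + (?u - us) - ?p) (?v - ?u) + inner (\<nu> *\<^sub>R ?v + (?v - us) - ?q) (?u - ?v)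
        = inner (?p - ?q) (?u - ?v) - (\<nu> + 1) * inner (?u - ?v) (?u - ?v)"
      by (simp add: inner_simps algebra_simps inner_commute)
    ultimately have "(\<nu> + 1) * (norm (?u - ?v))\<^sup>2 \<le> inner (?p - ?q) (?u - ?v) + (e (r i) + e (r j)) * norm (?u - ?v)"
      by (simp add: power2_norm_eq_inner norm_minus_commute[of ?v ?u] distrib_right)
    also have "inner (?p - ?q) (?u - ?v) \<le> norm (?p - ?q) * norm (?u - ?v)" by (rule norm_cauchy_schwarz)
    finally have "(\<nu> + 1) * (norm (?u - ?v))\<^sup>2 \<le> (norm (?p - ?q) + e (r i) + e (r j)) * norm (?u - ?v)"
      by (simp add: distrib_right)
    moreover have "(norm (?u - ?v))\<^sup>2 \<le> (\<nu> + 1) * (norm (?u - ?v))\<^sup>2" using \<nu> by (simp add: distrib_right)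
    ultimately have "norm (?u - ?v) * norm (?u - ?v) \<le> (norm (?p - ?q) + e (r i) + e (r j)) * norm (?u - ?v)"
      by (simp add: power2_eq_square)
    then show "dist ?u ?v \<le> dist ?p ?q + e (r i) + e (r j)"
      using mult_right_le_imp_le[of "norm (?u - ?v)" "norm (?u - ?v)" "norm (?p - ?q) + e (r i) + e (r j)"]
        e(1)[of "r i"] e(1)[of "r j"] by (cases "?u = ?v") (simp_all add: dist_norm)
  qed
  then obtain ub where ub: "(\<lambda>n. u (r n)) \<longlonglongrightarrow> ub" using Cauchy_convergent convergent_def by blast
  have ubU: "ub \<in> U0" by (rule closed_sequentially[OF U0(1) uU ub])
  have "\<exists>s yb. strict_mono s \<and> (\<lambda>n. y (r (s n))) \<longlonglongrightarrow> yb \<and> yb \<in> cball ys \<delta> \<and> yb \<in> qvi_solutions A \<Phi> (L ub + 0)"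
  proof (rule penalised_limit[OF r])
    show "(\<lambda>n. L (u (r n)) + ry (r n)) \<longlonglongrightarrow> L ub + 0"
      using LIMSEQ_subseq_LIMSEQ[OF ry r] by (intro tendsto_add blinfun.tendsto tendsto_const ub) (simp add: o_def)
    show "A (y (r n)) + P (r n) (y (r n) - \<Phi> (y (r n))) = L (u (r n)) + ry (r n)" for n
      by (simp add: ry_def S_def)
  qed (rule yB)
  then obtain s yb where s: "strict_mono s" and yb: "(\<lambda>n. y (r (s n))) \<longlonglongrightarrow> yb"
      and ybQ: "yb \<in> qvi_solutions A \<Phi> (into_dual \<iota> ub)" unfolding L by auto
  define t where "t = r \<circ> s"
  have t: "strict_mono t" unfolding t_def using r s by (rule strict_mono_o)
  have yt: "(\<lambda>n. y (t n)) \<longlonglongrightarrow> yb" using yb by (simp add: t_def)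
  have ut: "(\<lambda>n. u (t n)) \<longlonglongrightarrow> ub" using LIMSEQ_subseq_LIMSEQ[OF ub s] by (simp add: o_def t_def)
  have \<iota>pt: "(\<lambda>n. \<iota> (p (t n))) \<longlonglongrightarrow> \<iota> pb" using LIMSEQ_subseq_LIMSEQ[OF \<iota>p s] by (simp add: o_def t_def)
  have et: "(\<lambda>n. e (t n)) \<longlonglongrightarrow> 0" using LIMSEQ_subseq_LIMSEQ[OF e(2) t] by (simp add: o_def)
  have pt: "weak_tendsto (\<lambda>n. p (t n)) pb sequentially"
    unfolding weak_tendsto_def
  proof
    fix f :: "'v \<Rightarrow>\<^sub>L real"
    have "(\<lambda>n. f (p (r n))) \<longlonglongrightarrow> f pb" using weak by (simp add: weak_tendsto_def)
    from LIMSEQ_subseq_LIMSEQ[OF this s] show "(\<lambda>n. f (p (t n))) \<longlonglongrightarrow> f pb" by (simp add: o_def t_def)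
  qed
  \<comment> \<open>The limit value is at most the reference value. Local minimality gives the
    reverse inequality for the cost without the extra term, so the extra term vanishes and
    \<open>ub = us\<close>.\<close>
  have "fy yb + fu ub \<le> fy ys + fu us"
  proof (rule LIMSEQ_le)
    show "(\<lambda>n. V (t n)) \<longlonglongrightarrow> fy ys + fu us" using LIMSEQ_subseq_LIMSEQ[OF V t] by (simp add: o_def)
    show "(\<lambda>n. fy (y (t n)) + fu (u (t n))) \<longlonglongrightarrow> fy yb + fu ub"
      by (intro tendsto_add isCont_tendsto_compose[OF _ yt] isCont_tendsto_compose[OF _ ut]
          has_derivative_continuous[OF fy_der] has_derivative_continuous[OF fu_der])
    have "fy (y n) + fu (u n) \<le> V n" for n
      using val[of n] N_pos[of "S n (y n) - L (u n)"] \<tau>(1)[of n]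
        divide_nonneg_pos[of "N (S n (y n) - L (u n))" "2 * \<tau> n"] by linarith
    then show "\<exists>N. \<forall>n\<ge>N. fy (y (t n)) + fu (u (t n)) \<le> V (t n)" by blast
  qed
  moreover have "cost \<iota> \<nu> y\<^sub>d ys us \<le> cost \<iota> \<nu> y\<^sub>d yb ub"
    using ubU \<gamma>0(2) ybQ by (intro min) (auto simp: U0_def dist_norm norm_minus_commute)
  moreover have "cost \<iota> \<nu> y\<^sub>d ys us = fy ys + fu us" by (simp add: cost)
  ultimately have "(norm (ub - us))\<^sup>2 \<le> 0" using cost[of yb ub] by linarith
  then have ub_eq: "ub = us" by simp
  then have yb_eq: "yb = ys" using ybQ Q by simp
  have "0 \<le> inner (\<nu> *\<^sub>R us - \<iota> pb) (v - us)" if v: "v \<in> U0" for v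
  proof (rule LIMSEQ_le_const)
    have "(\<lambda>n. inner (\<nu> *\<^sub>R u (t n) + (u (t n) - us) - \<iota> (p (t n))) (v - u (t n)) + e (t n) * norm (v - u (t n)))
      \<longlonglongrightarrow> inner (\<nu> *\<^sub>R us + (us - us) - \<iota> pb) (v - us) + 0 * norm (v - us)"
      by (intro tendsto_add tendsto_inner tendsto_diff tendsto_scaleR tendsto_mult tendsto_norm
          tendsto_const ut[unfolded ub_eq] \<iota>pt et)
    then show "(\<lambda>n. inner (\<nu> *\<^sub>R u (t n) + (u (t n) - us) - \<iota> (p (t n))) (v - u (t n)) + e (t n) * norm (v - u (t n)))
      \<longlonglongrightarrow> inner (\<nu> *\<^sub>R us - \<iota> pb) (v - us)" by simp
  qed (use stat_u'[OF v] in blast)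
  then have "0 \<le> inner (\<nu> *\<^sub>R us - \<iota> pb) (v - us)" if "v \<in> U" for v
    using convex_local_variational_inequality[OF U(2) us \<gamma>0(1) that, of "\<nu> *\<^sub>R us - \<iota> pb"]
    by (simp add: U0_def dist_norm norm_minus_commute)
  then have "\<forall>v\<in>U. inner (\<nu> *\<^sub>R us - \<iota> pb) (us - v) \<le> 0" by (simp add: inner_diff_right)
  moreover have "inner (\<iota> ys - y\<^sub>d) (\<iota> x) + A x pb \<le> 0" if "pb = (id_blinfun - D\<Phi> ys) x" for x
  proof (rule multiplier_sign[OF yB yt[unfolded yb_eq] pt _ et _ _ that])
    show "bounded (range (\<lambda>n. p (t n)))"
      using p_bound r_ge by (intro boundedI[of _ "K * b / (C * a)"]) (auto simp: t_def)
    show "0 \<le> e (t n)" for n using e(1)[of "t n"] by simp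
    fix n x assume x: "p (t n) = (id_blinfun - D\<Phi> (y (t n))) x"
    have "t n \<ge> n0" using r_ge by (simp add: t_def)
    \<comment> \<open>In direction \<open>- x\<close> the penalty derivative contributes
      \<open>- P' (p (t n)) (p (t n))\<close>, which monotonicity allows to be discarded.\<close>
    from stat_y[OF int[OF this], of "- x"]
    have "- e (t n) * norm x \<le> - inner (\<iota> (y (t n)) - y\<^sub>d) (\<iota> x) + dS (t n) (y (t n)) (- x) (p (t n))"
      by (simp add: blinfun.minus_right)
    moreover have "dS (t n) (y (t n)) (- x) (p (t n)) \<le> - A x (p (t n))"
    proof -
      define P' where "P' = frechet_derivative (P (t n)) (at (y (t n) - \<Phi> (y (t n))))"
      have P': "(P (t n) has_derivative P') (at (y (t n) - \<Phi> (y (t n))))"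
        using P_differentiable by (simp add: P'_def frechet_derivative_works)
      have "(id_blinfun - D\<Phi> (y (t n))) (- x) = - p (t n)" by (simp only: x blinfun.minus_right)
      then have "dS (t n) (y (t n)) (- x) (p (t n)) = - A x (p (t n)) - P' (p (t n)) (p (t n))"
        by (simp add: dS_def P'_def[symmetric] linear_neg[OF has_derivative_linear[OF P']] blinfun.bilinear_simps)
      then show ?thesis using monotone_derivative_nonneg[OF P_mono P', of "p (t n)"] by simp
    qed
    ultimately show "inner (\<iota> (y (t n)) - y\<^sub>d) (\<iota> x) + A x (p (t n)) \<le> e (t n) * norm x" by simp
  qed
  ultimately show ?thesis by blast
qed

end

section \<open>Assembly of the optimality system\<close>

theorem theorem5p5:
  fixes \<iota> :: "'v::{banach, ordered_real_vector, lattice} \<Rightarrow>\<^sub>L 'h::{real_inner, complete_space}"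
    and A :: "'v \<Rightarrow>\<^sub>L 'v \<Rightarrow>\<^sub>L real"
    and \<Phi> :: "'v \<Rightarrow> 'v"
    and D\<Phi> :: "'v \<Rightarrow> 'v \<Rightarrow>\<^sub>L 'v"
    and m :: "real \<Rightarrow> 'h \<Rightarrow> 'v \<Rightarrow>\<^sub>L real"
    and U_ad :: "'h set"
    and y_d u_star :: 'h
    and y_star v0 :: 'v
    and \<nu> \<epsilon> C_a C_b :: real
  assumes reflexive: "reflexive_space TYPE('v)"
    and closed_cone: "closed {v::'v. 0 \<le> v}"
    and gelfand: "gelfand_embedding \<iota>"
    and compact: "compact_embedding \<iota>"
    and constants: "C_a > 0" "C_b > 0"
    and A_bounded: "\<And>u v. blinfun_apply (blinfun_apply A u) v \<le> C_b * norm u * norm v"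
    and A_coercive: "\<And>u. blinfun_apply (blinfun_apply A u) u \<ge> C_a * (norm u)\<^sup>2"
    and A_T_monotone: "\<And>u. blinfun_apply (blinfun_apply A (pos_part u)) (neg_part u) \<le> 0"
    and U_ad: "U_ad \<noteq> {}" "closed U_ad" "convex U_ad"
    and nu: "\<nu> > 0"
    and minimiser: "local_minimiser \<iota> A \<Phi> U_ad \<nu> y_d y_star u_star"
    and Phi_lower: "\<And>v. v0 \<le> \<Phi> v"
    and Phi_cc: "completely_continuous \<Phi>"
    and eps: "\<epsilon> > 0"
    and Phi_C1: "has_continuous_frechet_derivative_on \<Phi> D\<Phi> (cball y_star \<epsilon>)"
    and Q_single: "\<And>g. \<exists>y. qvi_solutions A \<Phi> g = {y}"
    and invertible: "\<And>z. z \<in> cball y_star \<epsilon> \<Longrightarrow> bij (blinfun_apply (id_blinfun - D\<Phi> z))"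
    and uniform: "\<exists>C_a'>0. \<exists>C_b'>0. \<forall>z\<in>cball y_star \<epsilon>. \<forall>w.
           norm (blinfun_apply A (inv (blinfun_apply (id_blinfun - D\<Phi> z)) w)) \<le> C_b' * norm w \<and>
           blinfun_apply (blinfun_apply A (inv (blinfun_apply (id_blinfun - D\<Phi> z)) w)) w
             \<ge> C_a' * (norm w)\<^sup>2"
    and penalty: "penalty_maps (\<lambda>\<rho> v. m \<rho> (blinfun_apply \<iota> v))"
    and m_cont: "\<And>\<rho>. \<rho> > 0 \<Longrightarrow> continuous_on UNIV (m \<rho>)"
    and m_C1: "\<And>\<rho>. \<rho> > 0 \<Longrightarrow>
           \<exists>m'. has_continuous_frechet_derivative_on (\<lambda>v. m \<rho> (blinfun_apply \<iota> v)) m' UNIV"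
  shows "\<exists>(p :: 'v) (\<xi> :: 'v \<Rightarrow>\<^sub>L real) (\<mu> :: 'v \<Rightarrow>\<^sub>L real).
           into_dual \<iota> (blinfun_apply \<iota> y_star) + dual_map (id_blinfun - D\<Phi> y_star) \<mu>
             + form_adjoint A p = into_dual \<iota> y_d \<and>
           blinfun_apply A y_star - into_dual \<iota> u_star + \<xi> = 0 \<and>
           dual_le 0 \<xi> \<and> y_star \<le> \<Phi> y_star \<and> blinfun_apply \<xi> (y_star - \<Phi> y_star) = 0 \<and>
           u_star \<in> U_ad \<and>
           (\<forall>v\<in>U_ad. inner (\<nu> *\<^sub>R u_star - blinfun_apply \<iota> p) (u_star - v) \<le> 0) \<and>
           blinfun_apply \<mu> p \<ge> 0"
proof -
  let ?T = "\<lambda>z. id_blinfun - D\<Phi> z"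
  obtain a b where ab: "a > 0" "b > 0"
    and unif: "\<And>z w. z \<in> cball y_star \<epsilon> \<Longrightarrow>
      norm (A (inv (blinfun_apply (?T z)) w)) \<le> b * norm w \<and>
      a * (norm w)\<^sup>2 \<le> A (inv (blinfun_apply (?T z)) w) w"
    using uniform by blast
  have unif_T: "norm (A x) \<le> b * norm (?T z x) \<and> a * (norm (?T z x))\<^sup>2 \<le> A x (?T z x)"
    if "z \<in> cball y_star \<epsilon>" for z x
    using unif[OF that, of "?T z x"] inv_f_f[OF bij_is_inj[OF invertible[OF that]], of x] by simp
  have center: "y_star \<in> cball y_star \<epsilon>" using eps by simp
  obtain c \<delta> l where const: "c > 0" "0 < \<delta>" "\<delta> \<le> \<epsilon>" "l > 0"
    and mono: "\<And>y z. y \<in> cball y_star \<delta> \<Longrightarrow> z \<in> cball y_star \<delta> \<Longrightarrow>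
      c * (norm (y - z))\<^sup>2 \<le> A (y - z) ((y - \<Phi> y) - (z - \<Phi> z))"
    and lip: "\<And>y z. y \<in> cball y_star \<delta> \<Longrightarrow> z \<in> cball y_star \<delta> \<Longrightarrow>
      norm ((y - \<Phi> y) - (z - \<Phi> z)) \<le> l * norm (y - z)"
    using local_strong_monotonicity[OF constants(1) A_coercive eps Phi_C1 ab] unif_T[OF center] by blast
  have sub: "z \<in> cball y_star \<epsilon>" if "z \<in> cball y_star \<delta>" for z using that const by auto
  interpret ordered_embedding \<iota> A C_a
    using constants A_coercive gelfand compact closed_cone
    by unfold_locales (auto simp: gelfand_embedding_def)
  have m_zero: "\<And>\<rho> v. \<rho> > 0 \<Longrightarrow> v \<le> 0 \<Longrightarrow> m \<rho> (\<iota> v) = 0"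
    and m_mono: "\<And>\<rho> u v. \<rho> > 0 \<Longrightarrow> 0 \<le> (m \<rho> (\<iota> u) - m \<rho> (\<iota> v)) (u - v)"
    using penalty by (simp_all add: penalty_maps_def)
  \<comment> \<open>The limit condition on the penalty family is applied to the constant family
    \<open>z\<close>.\<close>
  have m_detect: "z \<le> 0" if "\<And>\<rho>. \<rho> > 0 \<Longrightarrow> m \<rho> (\<iota> z) = 0" for z
  proof -
    have "weak_tendsto (\<lambda>_. z) z (at_right (0::real))" by (simp add: weak_tendsto_def)
    moreover have "((\<lambda>\<rho>. m \<rho> (\<iota> z)) \<longlongrightarrow> 0) (at_right 0)"
      using that by (intro tendsto_eventually) (auto simp: eventually_at_right_field intro: exI[of _ 1])
    ultimately show ?thesis using penalty unfolding penalty_maps_def by blast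
  qed
  have m_diff: "(\<lambda>v. m \<rho> (\<iota> v)) differentiable (at x)" if "\<rho> > 0" for \<rho> x
    using m_C1[OF that] unfolding has_continuous_frechet_derivative_on_def differentiable_def by blast
  \<comment> \<open>Bounds \<open>y - \<Phi> y\<close> over the whole ball; the penalties are
    constructed for a radius fixed beforehand.\<close>
  define R where "R = norm (y_star - \<Phi> y_star) + l * \<delta>"
  have R: "norm (y - \<Phi> y) \<le> R" if "y \<in> cball y_star \<delta>" for y
  proof -
    have "norm ((y - \<Phi> y) - (y_star - \<Phi> y_star)) \<le> l * norm (y - y_star)"
      using that const by (intro lip) auto
    also have "\<dots> \<le> l * \<delta>"
      using that const by (intro mult_left_mono) (auto simp: dist_norm norm_minus_commute)
    finally show ?thesis
      using norm_triangle_ineq2[of "y - \<Phi> y" "y_star - \<Phi> y_star"] unfolding R_def by linarith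
  qed
  obtain P :: "nat \<Rightarrow> 'v \<Rightarrow> 'v \<Rightarrow>\<^sub>L real" where P: "\<And>n v. v \<le> 0 \<Longrightarrow> P n v = 0"
    "\<And>n u v. 0 \<le> (P n u - P n v) (u - v)"
    "\<And>n x. P n differentiable (at x)"
    "\<And>r w wb B. strict_mono r \<Longrightarrow> (\<And>n. norm (w n) \<le> R) \<Longrightarrow> (\<And>n. norm (P (r n) (w n)) \<le> B) \<Longrightarrow>
      (\<lambda>n. \<iota> (w n)) \<longlonglongrightarrow> \<iota> wb \<Longrightarrow> wb \<le> 0"
    using penalty_sequence[where m = m and R = R, OF m_zero m_mono m_cont m_detect m_diff] by blast
  have D\<Phi>: "\<And>z. z \<in> cball y_star \<epsilon> \<Longrightarrow> (\<Phi> has_derivative D\<Phi> z) (at z)" "continuous_on (cball y_star \<epsilon>) D\<Phi>"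
    using Phi_C1 by (auto simp: has_continuous_frechet_derivative_on_def)
  interpret penalised_qvi \<iota> A C_a \<Phi> D\<Phi> P y_star \<delta> c l a b
  proof
    show "continuous_on (cball y_star \<delta>) D\<Phi>" by (rule continuous_on_subset[OF D\<Phi>(2)]) (use sub in blast)
    show "wb \<le> 0" if "strict_mono r" "\<And>n. y n \<in> cball y_star \<delta>"
      "\<And>n. norm (P (r n) (y n - \<Phi> (y n))) \<le> B" "(\<lambda>n. \<iota> (y n - \<Phi> (y n))) \<longlonglongrightarrow> \<iota> wb" for r y wb B
      using P(4)[OF that(1) _ that(3,4)] R that(2) by blast
    show "norm (A x) \<le> b * norm (?T y x)" "a * (norm (?T y x))\<^sup>2 \<le> A x (?T y x)"
      if "y \<in> cball y_star \<delta>" for y x using unif_T[OF sub[OF that]] by blast+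
  qed (fact Phi_cc const ab mono lip P(1-3) | intro D\<Phi>(1) invertible sub; assumption)+
  obtain \<gamma> where us: "u_star \<in> U_ad" and Q: "qvi_solutions A \<Phi> (into_dual \<iota> u_star) = {y_star}" and "\<gamma> > 0"
    and min: "\<And>u y. u \<in> U_ad \<Longrightarrow> norm (u - u_star) \<le> \<gamma> \<Longrightarrow> y \<in> qvi_solutions A \<Phi> (into_dual \<iota> u) \<Longrightarrow>
      cost \<iota> \<nu> y_d y_star u_star \<le> cost \<iota> \<nu> y_d y u"
    using minimiser unfolding local_minimiser_def by blast
  obtain p where p: "\<forall>v\<in>U_ad. inner (\<nu> *\<^sub>R u_star - \<iota> p) (u_star - v) \<le> 0"
    and sign: "\<And>x. p = ?T y_star x \<Longrightarrow> inner (\<iota> y_star - y_d) (\<iota> x) + A x p \<le> 0"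
    using stationary_multiplier[OF us U_ad(2,3) nu Q \<open>\<gamma> > 0\<close> min] by blast
  obtain S :: "'v \<Rightarrow>\<^sub>L 'v" where S: "\<And>x. S (?T y_star x) = x" "\<And>w. ?T y_star (S w) = w"
    using inverse_derivative by blast
  define \<xi> where "\<xi> = into_dual \<iota> u_star - A y_star"
  \<comment> \<open>The adjoint equation is solved for the multiplier by composing with the inverse
    \<open>S\<close> of \<open>id_blinfun - D\<Phi> y_star\<close>. Its value at \<open>p\<close> is
    then minus the expression in \<open>sign\<close> at \<open>x = S p\<close>.\<close>
  define \<mu> where "\<mu> = (into_dual \<iota> y_d - into_dual \<iota> (\<iota> y_star) - form_adjoint A p) o\<^sub>L S"
  have y_le: "y_star \<le> \<Phi> y_star" and vi: "\<And>v. v \<le> \<Phi> y_star \<Longrightarrow> 0 \<le> \<xi> (y_star - v)"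
  proof -
    have "y_star \<in> qvi_solutions A \<Phi> (into_dual \<iota> u_star)" using Q by simp
    then show "y_star \<le> \<Phi> y_star" "\<And>v. v \<le> \<Phi> y_star \<Longrightarrow> 0 \<le> \<xi> (y_star - v)"
      by (simp_all add: qvi_solutions_def \<xi>_def blinfun.diff_left)
  qed
  \<comment> \<open>For \<open>v \<ge> 0\<close> the point \<open>y_star - v\<close> still lies
    below the obstacle and is an admissible test.\<close>
  have \<xi>_pos: "0 \<le> \<xi> v" if "0 \<le> v" for v
    using vi[of "y_star - v"] order_trans[OF _ y_le, of "y_star - v"] that by simp
  have "0 \<le> \<xi> (y_star - \<Phi> y_star)" using vi[of "\<Phi> y_star"] by simp
  moreover have "0 \<le> \<xi> (\<Phi> y_star - y_star)" using y_le by (intro \<xi>_pos) simp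
  ultimately have compl: "\<xi> (y_star - \<Phi> y_star) = 0" by (simp add: blinfun.diff_right)
  have "dual_map (?T y_star) \<mu> = into_dual \<iota> y_d - into_dual \<iota> (\<iota> y_star) - form_adjoint A p"
    by (rule blinfun_eqI) (simp only: \<mu>_def dual_map_def blinfun_apply_blinfun_compose S(1))
  then have "into_dual \<iota> (\<iota> y_star) + dual_map (?T y_star) \<mu> + form_adjoint A p = into_dual \<iota> y_d"
    by simp
  moreover have "0 \<le> \<mu> p"
    using sign[of "S p"] S(2)[of p]
    by (simp add: \<mu>_def into_dual_apply form_adjoint.rep_eq blinfun.bilinear_simps inner_diff_left)
  moreover have "dual_le 0 \<xi>" using \<xi>_pos by (simp add: dual_le_def)
  moreover have "A y_star - into_dual \<iota> u_star + \<xi> = 0" by (simp add: \<xi>_def)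
  ultimately show ?thesis using y_le compl us p by blast
qed

end
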